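(* Let $R=k[t^{a_1},\dots,t^{a_n}]$ be a numerical semigroup ring, and let $I$ be a homogeneous ideal of $R$ with minimal homogeneous generating set $x_1,\dots,x_m$ and minimal homogeneous presentation matrix $A$. Then $$I_1(A)=\sum_{j=1}^m\sum_{i\ne j}(x_i:x_j)\ \subseteq\ \operatorname{tr}_R(\Omega^1_R(I))\ \subseteq\ \sum_{j=2}^m\sum_{i<j}\operatorname{tr}_R\big((x_i:x_j)\big),$$ with equalities if each of the two-generated ideals $(x_i,x_j)$ for $i\ne j$ is reflexive, e.g. if $R$ is Gorenstein.
   Context: Here $k$ is a field and $a_1<\cdots<a_n$ are the minimal generators of a numerical semigroup (so $\gcd(a_1,\dots,a_n)=1$); $R\subseteq k[t]$ is graded with $t$ in degree $1$. For $x,y\in R$, $(x:y)=\{r\in R\mid ry\in xR\}$, an ideal of $R$. The trace ideal of an $R$-module $M$ is $\operatorname{tr}_R(M)=\langle f(x)\mid f\in\operatorname{Hom}_R(M,R),\ x\in M\rangle$. $\Omega^1_R(I)$ is the first syzygy of $I$, i.e. the kernel of the surjection $R^{\oplus m}\to I$, $e_i\mapsto x_i$. A minimal homogeneous presentation matrix of $I$ is the matrix $A$ in a minimal graded presentation $R^{\oplus q}\xrightarrow{A}R^{\oplus m}\to I\to0$, and $I_1(A)$ is the ideal generated by its entries. A module $N$ is reflexive if the natural map $N\to N^{**}$ is an isomorphism, where $(-)^*=\operatorname{Hom}_R(-,R)$. *)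

theory Defs
  imports
    "HOL-Computational_Algebra.Polynomial"
    "HOL-Computational_Algebra.Fraction_Field"
    "HOL-Algebra.Ring_Divisibility"
    "HOL-Algebra.Generated_Rings"
    "HOL-Algebra.Module"
begin

section \<open>Modules over commutative rings\<close>

text \<open>
  The multiplicative fields of a \<^type>\<open>module\<close> record play no role for modules; they are left
  undefined in the modules built below.
\<close>

definition module_hom ::
  "('a, 'r) ring_scheme \<Rightarrow> ('a, 'b, 'm) module_scheme \<Rightarrow> ('a, 'c, 'n) module_scheme \<Rightarrow> ('b \<Rightarrow> 'c) set"
  where "module_hom R M N =
    {f. f \<in> carrier M \<rightarrow> carrier N \<and>
        (\<forall>u\<in>carrier M. \<forall>v\<in>carrier M. f (u \<oplus>\<^bsub>M\<^esub> v) = f u \<oplus>\<^bsub>N\<^esub> f v) \<and>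
        (\<forall>r\<in>carrier R. \<forall>v\<in>carrier M. f (r \<odot>\<^bsub>M\<^esub> v) = r \<odot>\<^bsub>N\<^esub> f v)}"

definition module_iso ::
  "('a, 'r) ring_scheme \<Rightarrow> ('a, 'b, 'm) module_scheme \<Rightarrow> ('a, 'c, 'n) module_scheme \<Rightarrow> ('b \<Rightarrow> 'c) set"
  where "module_iso R M N = {f \<in> module_hom R M N. bij_betw f (carrier M) (carrier N)}"

definition ring_module :: "('a, 'r) ring_scheme \<Rightarrow> ('a, 'a) module"
  where "ring_module R =
    \<lparr>carrier = carrier R, mult = undefined, one = undefined,
     zero = \<zero>\<^bsub>R\<^esub>, add = add R, smult = mult R\<rparr>"

definition ideal_module :: "('a, 'r) ring_scheme \<Rightarrow> 'a set \<Rightarrow> ('a, 'a) module"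
  where "ideal_module R J = (ring_module R)\<lparr>carrier := J\<rparr>"

text \<open>
  The free module of rank \<open>m\<close>, with coordinates indexed by \<open>{1..m}\<close>. Vectors are zero outside
  that range, so that equal vectors are equal functions.
\<close>

definition free_module :: "('a, 'r) ring_scheme \<Rightarrow> nat \<Rightarrow> ('a, nat \<Rightarrow> 'a) module"
  where "free_module R m =
    \<lparr>carrier = {v. (\<forall>i\<in>{1..m}. v i \<in> carrier R) \<and> (\<forall>i. i \<notin> {1..m} \<longrightarrow> v i = \<zero>\<^bsub>R\<^esub>)},
     mult = undefined, one = undefined,
     zero = (\<lambda>i. \<zero>\<^bsub>R\<^esub>),
     add = (\<lambda>u v i. u i \<oplus>\<^bsub>R\<^esub> v i),
     smult = (\<lambda>r v i. r \<otimes>\<^bsub>R\<^esub> v i)\<rparr>"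

text \<open>
  The dual \<open>Hom(M, R)\<close>. Homomorphisms are taken to be \<^const>\<open>undefined\<close> outside \<open>carrier M\<close>, so
  that two homomorphisms agreeing on \<open>M\<close> are the same element of the dual.
\<close>

definition dual_module :: "('a, 'r) ring_scheme \<Rightarrow> ('a, 'b, 'm) module_scheme \<Rightarrow> ('a, 'b \<Rightarrow> 'a) module"
  where "dual_module R M =
    \<lparr>carrier = module_hom R M (ring_module R) \<inter> extensional (carrier M),
     mult = undefined, one = undefined,
     zero = (\<lambda>v\<in>carrier M. \<zero>\<^bsub>R\<^esub>),
     add = (\<lambda>f g. \<lambda>v\<in>carrier M. f v \<oplus>\<^bsub>R\<^esub> g v),
     smult = (\<lambda>r f. \<lambda>v\<in>carrier M. r \<otimes>\<^bsub>R\<^esub> f v)\<rparr>"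

definition reflexive_module :: "('a, 'r) ring_scheme \<Rightarrow> ('a, 'b, 'm) module_scheme \<Rightarrow> bool"
  where "reflexive_module R M \<longleftrightarrow>
    (\<lambda>v\<in>carrier M. \<lambda>f\<in>carrier (dual_module R M). f v)
      \<in> module_iso R M (dual_module R (dual_module R M))"

definition trace_ideal :: "('a, 'r) ring_scheme \<Rightarrow> ('a, 'b, 'm) module_scheme \<Rightarrow> 'a set"
  where "trace_ideal R M =
    genideal R {f v | f v. f \<in> module_hom R M (ring_module R) \<and> v \<in> carrier M}"

definition colon :: "('a, 'r) ring_scheme \<Rightarrow> 'a \<Rightarrow> 'a \<Rightarrow> 'a set"
  where "colon R x y = {r \<in> carrier R. \<exists>s\<in>carrier R. r \<otimes>\<^bsub>R\<^esub> y = x \<otimes>\<^bsub>R\<^esub> s}"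

definition ideal_sum :: "('a, 'r) ring_scheme \<Rightarrow> 'i set \<Rightarrow> ('i \<Rightarrow> 'a set) \<Rightarrow> 'a set"
  where "ideal_sum R P J = genideal R (\<Union>p\<in>P. J p)"

definition first_syzygy :: "('a, 'r) ring_scheme \<Rightarrow> nat \<Rightarrow> (nat \<Rightarrow> 'a) \<Rightarrow> ('a, nat \<Rightarrow> 'a) module"
  where "first_syzygy R m x = (free_module R m)
    \<lparr>carrier := {v \<in> carrier (free_module R m). (\<Oplus>\<^bsub>R\<^esub>i\<in>{1..m}. v i \<otimes>\<^bsub>R\<^esub> x i) = \<zero>\<^bsub>R\<^esub>}\<rparr>"

text \<open>The map from the free module of rank \<open>q\<close> to the one of rank \<open>m\<close> given by an \<open>m\<close> by \<open>q\<close> matrix.\<close>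

definition mat_map ::
  "('a, 'r) ring_scheme \<Rightarrow> nat \<Rightarrow> nat \<Rightarrow> (nat \<Rightarrow> nat \<Rightarrow> 'a) \<Rightarrow> (nat \<Rightarrow> 'a) \<Rightarrow> (nat \<Rightarrow> 'a)"
  where "mat_map R m q A w =
    (\<lambda>i. if i \<in> {1..m} then \<Oplus>\<^bsub>R\<^esub>l\<in>{1..q}. A i l \<otimes>\<^bsub>R\<^esub> w l else \<zero>\<^bsub>R\<^esub>)"

definition entry_ideal :: "('a, 'r) ring_scheme \<Rightarrow> nat \<Rightarrow> nat \<Rightarrow> (nat \<Rightarrow> nat \<Rightarrow> 'a) \<Rightarrow> 'a set"
  where "entry_ideal R m q A = genideal R {A i l | i l. i \<in> {1..m} \<and> l \<in> {1..q}}"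


section \<open>Gorenstein rings\<close>

text \<open>
  The extension property is required for modules whose elements are drawn from the type of the
  ring elements. These include the ideals of \<open>R\<close> and \<open>R\<close> itself, so by Baer's criterion the
  extension property for modules on any other type follows.
\<close>

definition injective_module :: "'a ring \<Rightarrow> ('a, 'u) module \<Rightarrow> bool"
  where "injective_module R E \<longleftrightarrow> Module.module R E \<and>
    (\<forall>(M :: ('a, 'a) module) (N :: ('a, 'a) module) \<iota> g.
       Module.module R M \<and> Module.module R N \<and>
       \<iota> \<in> module_hom R M N \<and> inj_on \<iota> (carrier M) \<and> g \<in> module_hom R M E \<longrightarrow>
       (\<exists>h\<in>module_hom R N E. \<forall>v\<in>carrier M. h (\<iota> v) = g v))"

text \<open>
  There is an injective resolution \<open>0 \<rightarrow> M \<rightarrow> E 0 \<rightarrow> E 1 \<rightarrow> \<dots>\<close> with augmentation \<open>\<epsilon>\<close> and differentials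
  \<open>d i : E i \<rightarrow> E (i + 1)\<close> such that \<open>E i = 0\<close> for all \<open>i > s\<close>. The type \<open>'u\<close> is the universe from
  which the elements of the modules \<open>E i\<close> are drawn; a theorem assuming
  \<open>finite_injective_dimension TYPE('u) R M\<close> for a type variable \<open>'u\<close> thus covers resolutions by
  modules on arbitrary types.
\<close>

definition finite_injective_dimension ::
  "'u itself \<Rightarrow> 'a ring \<Rightarrow> ('a, 'b) module \<Rightarrow> bool"
  where "finite_injective_dimension U R M \<longleftrightarrow> Module.module R M \<and>
    (\<exists>(s :: nat) (E :: nat \<Rightarrow> ('a, 'u) module) \<epsilon> d.
       (\<forall>i. injective_module R (E i)) \<and>
       (\<forall>i>s. carrier (E i) = {\<zero>\<^bsub>E i\<^esub>}) \<and>
       \<epsilon> \<in> module_hom R M (E 0) \<and> inj_on \<epsilon> (carrier M) \<and>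
       (\<forall>i. d i \<in> module_hom R (E i) (E (Suc i))) \<and>
       \<epsilon> ` carrier M = {v \<in> carrier (E 0). d 0 v = \<zero>\<^bsub>E (Suc 0)\<^esub>} \<and>
       (\<forall>i. d i ` carrier (E i) =
            {v \<in> carrier (E (Suc i)). d (Suc i) v = \<zero>\<^bsub>E (Suc (Suc i))\<^esub>}))"

definition class_ring :: "'a::comm_ring_1 ring"
  where "class_ring = \<lparr>carrier = UNIV, mult = (*), one = 1, zero = 0, add = (+)\<rparr>"

text \<open>
  The localization at a prime \<open>P\<close> of a domain \<open>R\<close> that is a subring of a type of class
  \<^class>\<open>idom\<close>, realized inside the fraction field of that type.
\<close>

definition localization :: "'a::idom ring \<Rightarrow> 'a set \<Rightarrow> 'a fract ring"
  where "localization R P =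
    class_ring\<lparr>carrier := {Fract a b | a b. a \<in> carrier R \<and> b \<in> carrier R - P}\<rparr>"

text \<open>
  A Noetherian ring is Gorenstein if its localization at every maximal ideal has finite injective
  dimension over itself.
\<close>

definition gorenstein_ring :: "'u itself \<Rightarrow> 'a::idom ring \<Rightarrow> bool"
  where "gorenstein_ring U R \<longleftrightarrow> noetherian_ring R \<and>
    (\<forall>P. maximalideal P R \<longrightarrow>
       finite_injective_dimension U (localization R P) (ring_module (localization R P)))"


section \<open>Numerical semigroup rings\<close>

definition generated_semigroup :: "nat set \<Rightarrow> nat set"
  where "generated_semigroup G = {\<Sum>g\<in>G. c g * g | c. True}"

definition minimal_semigroup_generators :: "nat \<Rightarrow> (nat \<Rightarrow> nat) \<Rightarrow> bool"
  where "minimal_semigroup_generators n a \<longleftrightarrow>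
    strict_mono_on {1..n} a \<and> Gcd (a ` {1..n}) = 1 \<and>
    (\<forall>i\<in>{1..n}. a i \<notin> generated_semigroup (a ` ({1..n} - {i})))"

definition semigroup_ring :: "nat \<Rightarrow> (nat \<Rightarrow> nat) \<Rightarrow> 'k::field poly ring"
  where "semigroup_ring n a =
    class_ring\<lparr>carrier := generate_ring class_ring
      (range (\<lambda>c. [:c:]) \<union> (\<lambda>i. Polynomial.monom 1 (a i)) ` {1..n})\<rparr>"

definition homogeneous :: "'k::field poly \<Rightarrow> nat \<Rightarrow> bool"
  where "homogeneous p d \<longleftrightarrow> (\<forall>e. Polynomial.coeff p e \<noteq> 0 \<longrightarrow> e = d)"

definition homogeneous_ideal :: "'k::field poly set \<Rightarrow> 'k poly ring \<Rightarrow> bool"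
  where "homogeneous_ideal I R \<longleftrightarrow> ideal I R \<and>
    (\<forall>p\<in>I. \<forall>e. Polynomial.monom (Polynomial.coeff p e) e \<in> I)"

definition minimal_homogeneous_generators ::
  "'k::field poly ring \<Rightarrow> 'k poly set \<Rightarrow> nat \<Rightarrow> (nat \<Rightarrow> 'k poly) \<Rightarrow> bool"
  where "minimal_homogeneous_generators R I m x \<longleftrightarrow>
    (\<forall>i\<in>{1..m}. x i \<in> carrier R \<and> (\<exists>d. homogeneous (x i) d)) \<and>
    genideal R (x ` {1..m}) = I \<and>
    (\<forall>i\<in>{1..m}. genideal R (x ` ({1..m} - {i})) \<noteq> I)"

text \<open>
  \<open>A\<close> is an \<open>m\<close> by \<open>q\<close> matrix over \<open>R\<close> whose columns form a minimal generating set of the first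
  syzygy of \<open>x 1, \<dots>, x m\<close> (the vectors \<open>w\<close> with \<open>w l = 0\<close> give the span of the columns other than
  \<open>l\<close>) and are homogeneous: column \<open>l\<close> has degree \<open>\<delta> l\<close> in the graded free module whose basis vector
  \<open>i\<close> sits in degree \<open>degree (x i)\<close>, this being the degree of the nonzero homogeneous element \<open>x i\<close>.
\<close>

definition minimal_homogeneous_presentation ::
  "'k::field poly ring \<Rightarrow> nat \<Rightarrow> (nat \<Rightarrow> 'k poly) \<Rightarrow> nat \<Rightarrow> (nat \<Rightarrow> nat \<Rightarrow> 'k poly) \<Rightarrow> bool"
  where "minimal_homogeneous_presentation R m x q A \<longleftrightarrow>
    (\<forall>i\<in>{1..m}. \<forall>l\<in>{1..q}. A i l \<in> carrier R) \<and>
    (\<exists>\<delta> :: nat \<Rightarrow> nat. \<forall>i\<in>{1..m}. \<forall>l\<in>{1..q}. \<forall>e.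
       Polynomial.coeff (A i l) e \<noteq> 0 \<longrightarrow> e + Polynomial.degree (x i) = \<delta> l) \<and>
    mat_map R m q A ` carrier (free_module R q) = carrier (first_syzygy R m x) \<and>
    (\<forall>l\<in>{1..q}. mat_map R m q A ` {w \<in> carrier (free_module R q). w l = \<zero>\<^bsub>R\<^esub>}
       \<noteq> carrier (first_syzygy R m x))"

end

theory Submission
  imports Defs
begin

text \<open>
  The semigroup \<open>S\<close> generated by \<open>a 1, \<dots>, a n\<close> has finite complement in the natural numbers, \<open>R\<close>
  consists of the polynomials supported on \<open>S\<close>, and the \<open>x i\<close> are nonzero multiples of powers
  \<open>t ^ b i\<close> with \<open>b i \<in> S\<close>.

  The three ideals. If \<open>r x j = s x i\<close>, then \<open>r e j - s e i\<close> is a syzygy of \<open>x 1, \<dots>, x m\<close>. Since the \<open>x i\<close>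
  are monomials, these binomial syzygies generate all syzygies (\<open>syzygy_induct\<close>): a term of one
  coordinate can only be cancelled against terms of the others. The coordinates of the binomial
  syzygies are exactly the elements of the colon ideals, so the entries of a presentation matrix
  generate the sum of the colon ideals. Coordinates are values of linear forms, whence the first
  inclusion. A linear form on the syzygies, restricted to the binomial syzygies of a pair \<open>i < j\<close>,
  is a linear form on the colon ideal \<open>(x i : x j)\<close>, whence the second inclusion.

  Reflexivity. A linear form \<open>f\<close> on \<open>(x : y)\<close> gives the element \<open>\<phi> \<mapsto> f (\<phi> x)\<close> of the bidual of the
  ideal \<open>J = (x, y)\<close>. If \<open>J\<close> is reflexive, this is evaluation at some \<open>\<alpha> x + \<beta> y \<in> J\<close>, and then
  \<open>f r = \<alpha> r + \<beta> s\<close> where \<open>r y = x s\<close>; so the trace of \<open>(x : y)\<close> lies in \<open>(x : y) + (y : x)\<close>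
  (\<open>trace_colon_subset\<close>), which closes the chain of inclusions.

  Gorenstein rings. Let \<open>B\<close> be the localization of \<open>R\<close> at the origin. The point is to extract from an
  injective resolution of \<open>B\<close>, of unknown finite length, that for \<open>a \<in> S\<close>, \<open>a > 0\<close>, the socle of
  \<open>R / t ^ a R\<close> is spanned by a single power of \<open>t\<close>. Only maps out of monomial ideals are used; such a
  map is a family \<open>z \<tau>\<close> with \<open>t ^ s z \<tau> = z (\<tau> + s)\<close>, and extending the map to the whole ring means
  finding \<open>f\<close> with \<open>t ^ \<tau> f = z \<tau>\<close>. In injective modules such an \<open>f\<close> always exists
  (\<open>injective_extends\<close>). For the image of a differential of the resolution it exists as well, at
  least for ideals of finite colength (\<open>extends_cocycles\<close>); this is the classical argument that a
  finite injective dimension cannot exceed the depth, which is 1 here, and it descends from the end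
  of the resolution. So \<open>E 0\<close> and \<open>E 0 / B\<close> are injective with respect to the ideals
  that matter, and a linear map between two lines in the socle of \<open>B / t ^ a B\<close> is multiplication by an
  element of \<open>B\<close>, as over a self-injective ring; this forces the socle to be simple
  (\<open>socle_degree_unique\<close>). A simple socle is a symmetry of the Apery set of \<open>S\<close> with respect to \<open>a\<close>,
  and for \<open>a = b i\<close> this symmetry yields \<open>(x i) : ((x i) : x j) = (x i, x j)\<close> in terms of
  exponents (\<open>double_colon_degrees\<close>). The latter property of a pair is reflexivity
  (\<open>reflexive_pairI\<close>).
\<close>

section \<open>Subrings of integral domains\<close>

lemma class_ring_simps [simp]:
  "u \<otimes>\<^bsub>class_ring\<^esub> v = u * v" "u \<oplus>\<^bsub>class_ring\<^esub> v = u + v"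
  "\<zero>\<^bsub>class_ring\<^esub> = 0" "\<one>\<^bsub>class_ring\<^esub> = 1"
  by (auto simp: class_ring_def)

text \<open>
  The semigroup ring inside \<open>k[t]\<close> and its localization inside the field of fractions of \<open>k[t]\<close> are both
  of this form.
\<close>

locale domain_subring =
  fixes C :: "'a::idom set"
  assumes zero_mem: "0 \<in> C"
    and one_mem: "1 \<in> C"
    and add_mem: "u \<in> C \<Longrightarrow> v \<in> C \<Longrightarrow> u + v \<in> C"
    and mult_mem: "u \<in> C \<Longrightarrow> v \<in> C \<Longrightarrow> u * v \<in> C"
    and uminus_mem: "u \<in> C \<Longrightarrow> - u \<in> C"
begin

abbreviation R :: "'a ring"
  where "R \<equiv> class_ring\<lparr>carrier := C\<rparr>"

lemma diff_mem: "u \<in> C \<Longrightarrow> v \<in> C \<Longrightarrow> u - v \<in> C"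
  using add_mem[of u "- v"] uminus_mem[of v] by simp

lemma cring_R: "cring R"
proof (rule cringI)
  show "abelian_group R"
  proof (rule abelian_groupI)
    fix u
    assume "u \<in> carrier R"
    then show "\<exists>v\<in>carrier R. v \<oplus>\<^bsub>R\<^esub> u = \<zero>\<^bsub>R\<^esub>"
      by (intro bexI[of _ "- u"]) (auto simp: uminus_mem)
  qed (auto simp: add_mem zero_mem algebra_simps)
  show "comm_monoid R"
    by (rule comm_monoidI) (auto intro: mult_mem one_mem simp: algebra_simps)
qed (auto simp: algebra_simps)

sublocale cring R
  by (rule cring_R)

lemma finsum_eq_sum: "f \<in> K \<rightarrow> C \<Longrightarrow> finsum R f K = sum f K"
  if "finite K"
  using that
proof (induction K rule: finite_induct)
  case (insert k K)
  then show ?case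
    by (subst finsum_insert) (auto simp: Pi_iff)
qed simp

lemma ideal_iff:
  "ideal J R \<longleftrightarrow> J \<subseteq> C \<and> 0 \<in> J \<and> (\<forall>u\<in>J. \<forall>v\<in>J. u + v \<in> J) \<and> (\<forall>r\<in>C. \<forall>u\<in>J. r * u \<in> J)"
  (is "_ \<longleftrightarrow> ?rhs")
proof
  assume J: "ideal J R"
  note J' = ideal.axioms(1)[OF J]
  show ?rhs
    using additive_subgroup.a_subset[OF J'] additive_subgroup.zero_closed[OF J']
      additive_subgroup.a_closed[OF J'] ideal.I_l_closed[OF J]
    by (simp add: subset_iff)
next
  assume J: ?rhs
  have inv: "inv\<^bsub>add_monoid R\<^esub> u = - u" if "u \<in> C" for u
    using that add.inv_equality[of "- u" u] uminus_mem by (simp add: a_inv_def)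
  have "subgroup J (add_monoid R)"
  proof (unfold_locales)
    fix u
    assume u: "u \<in> J"
    then have "(- 1) * u \<in> J"
      using J one_mem uminus_mem by blast
    with u J inv show "inv\<^bsub>add_monoid R\<^esub> u \<in> J"
      by auto
  qed (use J in auto)
  then show "ideal J R"
  proof (rule idealI[OF ring_axioms])
    fix u r
    assume "u \<in> J" "r \<in> carrier R"
    with J have "r * u \<in> J"
      by simp
    then show "r \<otimes>\<^bsub>R\<^esub> u \<in> J" "u \<otimes>\<^bsub>R\<^esub> r \<in> J"
      by (simp_all add: mult.commute[of u r])
  qed
qed

lemma genideal_upper: "X \<subseteq> genideal R X"
  unfolding genideal_def by blast

lemma genideal_pair_mem:
  assumes "u \<in> C" "v \<in> C" "z \<in> genideal R {u, v}"
  obtains \<alpha> \<beta> where "\<alpha> \<in> C" "\<beta> \<in> C" "z = \<alpha> * u + \<beta> * v"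
proof -
  let ?J = "{\<alpha> * u + \<beta> * v | \<alpha> \<beta>. \<alpha> \<in> C \<and> \<beta> \<in> C}"
  have "ideal ?J R"
    unfolding ideal_iff
  proof (intro conjI ballI)
    show "0 \<in> ?J"
      using zero_mem by force
  next
    fix w w'
    assume "w \<in> ?J" "w' \<in> ?J"
    then obtain \<alpha> \<beta> \<alpha>' \<beta>' where "w = \<alpha> * u + \<beta> * v" "w' = \<alpha>' * u + \<beta>' * v"
      "\<alpha> \<in> C" "\<beta> \<in> C" "\<alpha>' \<in> C" "\<beta>' \<in> C"
      by blast
    then show "w + w' \<in> ?J"
      by (intro CollectI exI[of _ "\<alpha> + \<alpha>'"] exI[of _ "\<beta> + \<beta>'"]) (auto simp: algebra_simps add_mem)
  next
    fix r w
    assume "r \<in> C" "w \<in> ?J"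
    then obtain \<alpha> \<beta> where "w = \<alpha> * u + \<beta> * v" "\<alpha> \<in> C" "\<beta> \<in> C"
      by blast
    with \<open>r \<in> C\<close> show "r * w \<in> ?J"
      by (intro CollectI exI[of _ "r * \<alpha>"] exI[of _ "r * \<beta>"]) (auto simp: algebra_simps mult_mem)
  qed (use assms in \<open>auto intro: add_mem mult_mem\<close>)
  moreover have "{u, v} \<subseteq> ?J"
    using zero_mem one_mem by force
  ultimately have "genideal R {u, v} \<subseteq> ?J"
    by (rule genideal_minimal)
  with assms(3) that show thesis
    by blast
qed

lemma ideal_sum_upper: "p \<in> P \<Longrightarrow> J p \<subseteq> ideal_sum R P J"
  unfolding ideal_sum_def by (rule subset_trans[OF _ genideal_upper]) blast

lemma ideal_sum_least: "ideal K R \<Longrightarrow> (\<And>p. p \<in> P \<Longrightarrow> J p \<subseteq> K) \<Longrightarrow> ideal_sum R P J \<subseteq> K"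
  unfolding ideal_sum_def by (rule genideal_minimal) auto

lemma ideal_ideal_sum: "(\<And>p. p \<in> P \<Longrightarrow> J p \<subseteq> C) \<Longrightarrow> ideal (ideal_sum R P J) R"
  unfolding ideal_sum_def by (rule genideal_ideal) auto

lemma module_hom_ideal_iff:
  "f \<in> module_hom R (ideal_module R J) (ring_module R) \<longleftrightarrow>
    (\<forall>u\<in>J. f u \<in> C) \<and> (\<forall>u\<in>J. \<forall>v\<in>J. f (u + v) = f u + f v) \<and>
    (\<forall>r\<in>C. \<forall>u\<in>J. f (r * u) = r * f u)"
  by (auto simp: module_hom_def ideal_module_def ring_module_def Pi_iff)

lemma trace_ideal_carrier:
  "{f v | f v. f \<in> module_hom R M (ring_module R) \<and> v \<in> carrier M} \<subseteq> C"
  by (auto simp: module_hom_def ring_module_def Pi_iff)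

lemma ideal_trace_ideal: "ideal (trace_ideal R M) R"
  unfolding trace_ideal_def
proof (rule genideal_ideal)
  show "{f v | f v. f \<in> module_hom R M (ring_module R) \<and> v \<in> carrier M} \<subseteq> carrier R"
    using trace_ideal_carrier by simp
qed

lemma trace_ideal_subset: "trace_ideal R M \<subseteq> C"
  by (rule conjunct1[OF iffD1[OF ideal_iff ideal_trace_ideal]])

lemma trace_ideal_upper:
  "f \<in> module_hom R M (ring_module R) \<Longrightarrow> v \<in> carrier M \<Longrightarrow> f v \<in> trace_ideal R M"
  unfolding trace_ideal_def by (rule subsetD[OF genideal_upper]) blast

lemma trace_ideal_least:
  assumes "ideal K R"
    and "\<And>f v. f \<in> module_hom R M (ring_module R) \<Longrightarrow> v \<in> carrier M \<Longrightarrow> f v \<in> K"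
  shows "trace_ideal R M \<subseteq> K"
  unfolding trace_ideal_def by (rule genideal_minimal) (use assms in auto)

lemma colon_iff: "r \<in> colon R u v \<longleftrightarrow> r \<in> C \<and> (\<exists>s\<in>C. r * v = u * s)"
  by (auto simp: colon_def)

lemma module_ideal_module:
  assumes "ideal J R"
  shows "Module.module R (ideal_module R J)"
proof (rule moduleI[OF cring_R])
  note J = assms[unfolded ideal_iff]
  show "abelian_group (ideal_module R J)"
  proof (rule abelian_groupI)
    fix u
    assume u: "u \<in> carrier (ideal_module R J)"
    then have "u \<in> J"
      by (simp add: ideal_module_def)
    then have "(- 1) * u \<in> J"
      using J one_mem uminus_mem by blast
    then have "- u \<in> J"
      by simp
    then show "\<exists>v\<in>carrier (ideal_module R J). v \<oplus>\<^bsub>ideal_module R J\<^esub> u = \<zero>\<^bsub>ideal_module R J\<^esub>"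
      by (intro bexI[of _ "- u"]) (auto simp: ideal_module_def ring_module_def)
  qed (use J in \<open>auto simp: ideal_module_def ring_module_def algebra_simps\<close>)
qed (use assms[unfolded ideal_iff] in \<open>auto simp: ideal_module_def ring_module_def algebra_simps\<close>)

lemma ideal_module_carrier: "ideal_module R C = ring_module R"
  by (simp add: ideal_module_def ring_module_def)

lemma module_ring_module: "Module.module R (ring_module R)"
  using module_ideal_module[OF oneideal] by (simp add: ideal_module_carrier)

end


section \<open>Reflexivity of ideals generated by two elements\<close>

context domain_subring
begin

lemma dual_ideal_iff:
  "\<phi> \<in> carrier (dual_module R (ideal_module R J)) \<longleftrightarrow>
    \<phi> \<in> module_hom R (ideal_module R J) (ring_module R) \<and> \<phi> \<in> extensional J"
  by (simp add: dual_module_def ideal_module_def)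

lemma dual_ideal_add:
  "\<phi> \<oplus>\<^bsub>dual_module R (ideal_module R J)\<^esub> \<psi> = (\<lambda>v\<in>J. \<phi> v + \<psi> v)"
  by (simp add: dual_module_def ideal_module_def)

lemma dual_ideal_smult:
  "r \<odot>\<^bsub>dual_module R (ideal_module R J)\<^esub> \<phi> = (\<lambda>v\<in>J. r * \<phi> v)"
  by (simp add: dual_module_def ideal_module_def)

lemma bidual_iff:
  "\<Phi> \<in> carrier (dual_module R (dual_module R (ideal_module R J))) \<longleftrightarrow>
    \<Phi> \<in> extensional (carrier (dual_module R (ideal_module R J))) \<and>
    (\<forall>\<phi>\<in>carrier (dual_module R (ideal_module R J)). \<Phi> \<phi> \<in> C) \<and>
    (\<forall>\<phi>\<in>carrier (dual_module R (ideal_module R J)).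
      \<forall>\<psi>\<in>carrier (dual_module R (ideal_module R J)).
        \<Phi> (\<lambda>v\<in>J. \<phi> v + \<psi> v) = \<Phi> \<phi> + \<Phi> \<psi>) \<and>
    (\<forall>r\<in>C. \<forall>\<phi>\<in>carrier (dual_module R (ideal_module R J)). \<Phi> (\<lambda>v\<in>J. r * \<phi> v) = r * \<Phi> \<phi>)"
proof -
  let ?D = "dual_module R (ideal_module R J)"
  have "\<Phi> \<in> carrier (dual_module R ?D) \<longleftrightarrow>
    \<Phi> \<in> module_hom R ?D (ring_module R) \<and> \<Phi> \<in> extensional (carrier ?D)"
    by (simp add: dual_module_def)
  then show ?thesis
    unfolding module_hom_def dual_ideal_add dual_ideal_smult
    by (auto simp: ring_module_def Pi_iff)
qed

text \<open>
  Both sides are \<open>\<phi> (u v)\<close>. Hence a linear form on an ideal is determined by a single value \<open>\<phi> u\<close>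
  with \<open>u \<noteq> 0\<close>, and \<open>\<phi> u\<close> lies in every colon ideal \<open>(u : v)\<close> with \<open>v\<close> in the ideal.
\<close>

lemma dual_ideal_cross:
  assumes "ideal J R" "\<phi> \<in> carrier (dual_module R (ideal_module R J))" "u \<in> J" "v \<in> J"
  shows "\<phi> u * v = u * \<phi> v"
proof -
  have "u \<in> C" "v \<in> C"
    using assms by (auto simp: ideal_iff)
  then have "v * \<phi> u = \<phi> (v * u)" "\<phi> (u * v) = u * \<phi> v"
    using assms by (auto simp: dual_ideal_iff module_hom_ideal_iff)
  then show ?thesis
    by (simp add: mult.commute)
qed

lemma inclusion_in_dual:
  assumes "ideal J R"
  shows "(\<lambda>v\<in>J. v) \<in> carrier (dual_module R (ideal_module R J))"
  using assms by (auto simp: dual_ideal_iff module_hom_ideal_iff ideal_iff)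

lemma ideal_pair: "u \<in> C \<Longrightarrow> v \<in> C \<Longrightarrow> ideal (genideal R {u, v}) R"
  by (rule genideal_ideal) simp

lemma pair_mem: "u \<in> genideal R {u, v}" "v \<in> genideal R {u, v}"
  using genideal_upper[of "{u, v}"] by simp_all

lemma colon_self: "u \<in> C \<Longrightarrow> v \<in> C \<Longrightarrow> u \<in> colon R u v"
  unfolding colon_iff by blast

text \<open>
  A linear form \<open>f\<close> on \<open>(u : v)\<close> satisfies \<open>u f r = f (u r) = r f u\<close>, so it is division by \<open>u\<close> followed
  by multiplication by \<open>f u\<close>. Reflexivity places \<open>f u\<close> in \<open>(u, v)\<close>: the assignment \<open>\<phi> \<mapsto> f (\<phi> u)\<close> is an
  element of the bidual that sends the inclusion to \<open>f u\<close>.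
\<close>

lemma trace_colon_subset:
  assumes u: "u \<in> C" "u \<noteq> 0" and v: "v \<in> C"
    and refl: "reflexive_module R (ideal_module R (genideal R {u, v}))"
    and K: "ideal K R" "colon R u v \<subseteq> K" "colon R v u \<subseteq> K"
  shows "trace_ideal R (ideal_module R (colon R u v)) \<subseteq> K"
proof (rule trace_ideal_least[OF K(1)])
  let ?J = "genideal R {u, v}"
  let ?D = "dual_module R (ideal_module R ?J)"
  fix f r
  assume f: "f \<in> module_hom R (ideal_module R (colon R u v)) (ring_module R)"
    and "r \<in> carrier (ideal_module R (colon R u v))"
  then have r: "r \<in> colon R u v"
    by (simp add: ideal_module_def)
  note f = f[unfolded module_hom_ideal_iff]
  note J = ideal_pair[OF u(1) v]
  have colon: "\<phi> u \<in> colon R u v" if "\<phi> \<in> carrier ?D" for \<phi>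
    using dual_ideal_cross[OF J that pair_mem] that pair_mem(1)[of u v] pair_mem(2)[of v u]
    by (auto simp: colon_iff dual_ideal_iff module_hom_ideal_iff)
  let ?\<Phi> = "\<lambda>\<phi>\<in>carrier ?D. f (\<phi> u)"
  have lin: "(\<lambda>w\<in>?J. \<phi> w + \<psi> w) \<in> carrier ?D" "(\<lambda>w\<in>?J. c * \<phi> w) \<in> carrier ?D"
    if "\<phi> \<in> carrier ?D" "\<psi> \<in> carrier ?D" "c \<in> C" for \<phi> \<psi> c
    using that J
    by (auto simp: dual_ideal_iff module_hom_ideal_iff ideal_iff algebra_simps add_mem mult_mem)
  have "?\<Phi> \<in> carrier (dual_module R ?D)"
    unfolding bidual_iff using f colon lin pair_mem[of u v] zero_mem
    by (auto simp del: restrict_apply simp: restrict_apply')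
  moreover have "(\<lambda>w\<in>?J. \<lambda>\<phi>\<in>carrier ?D. \<phi> w) ` ?J = carrier (dual_module R ?D)"
    using refl by (auto simp: reflexive_module_def module_iso_def bij_betw_def ideal_module_def)
  ultimately obtain z where z: "z \<in> ?J" and "?\<Phi> = (\<lambda>\<phi>\<in>carrier ?D. \<phi> z)"
    by auto
  from this(2) have "?\<Phi> (\<lambda>w\<in>?J. w) = (\<lambda>\<phi>\<in>carrier ?D. \<phi> z) (\<lambda>w\<in>?J. w)"
    by (rule arg_cong)
  then have fu: "f u = z"
    using inclusion_in_dual[OF J] z pair_mem[of u v] by simp
  obtain \<alpha> \<beta> where \<alpha>\<beta>: "\<alpha> \<in> C" "\<beta> \<in> C" "z = \<alpha> * u + \<beta> * v"
    using genideal_pair_mem[OF u(1) v z] .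
  obtain s where s: "s \<in> C" "r * v = u * s" and rC: "r \<in> C"
    using r by (auto simp: colon_iff)
  have "u * f r = f (u * r)"
    using f r u by simp
  also have "\<dots> = r * f u"
    using f rC colon_self[OF u(1) v] by (simp add: mult.commute[of u r])
  also have "\<dots> = u * (\<alpha> * r + \<beta> * s)"
    unfolding fu \<alpha>\<beta>(3) using s(2) by (simp add: algebra_simps)
  finally have "f r = \<alpha> * r + \<beta> * s"
    using u(2) by simp
  moreover have "s \<in> colon R v u"
    using s rC by (auto simp: colon_iff mult.commute intro!: bexI[of _ r])
  ultimately have "f r = \<alpha> * r + \<beta> * s" "r \<in> K" "s \<in> K"
    using K r by auto
  then show "f r \<in> K"
    using K(1) \<alpha>\<beta> by (simp add: ideal_iff)
qed

text \<open>
  The hypothesis \<open>dbl\<close> says \<open>(u) : ((u) : v) = (u, v)\<close>. The dual of \<open>J = (u, v)\<close> is \<open>(u : v)\<close> via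
  \<open>\<phi> \<mapsto> \<phi> u\<close>, and \<open>u \<phi> = (\<phi> u) \<iota>\<close> for the inclusion \<open>\<iota>\<close> of \<open>J\<close>. Therefore an element \<open>\<Phi>\<close> of the
  bidual is determined by \<open>z = \<Phi> \<iota>\<close>, which satisfies \<open>(u : v) z \<subseteq> (u)\<close>.
\<close>

lemma reflexive_pairI:
  assumes u: "u \<in> C" "u \<noteq> 0" and v: "v \<in> C"
    and dbl: "\<And>z. z \<in> C \<Longrightarrow> (\<And>r. r \<in> colon R u v \<Longrightarrow> \<exists>s\<in>C. r * z = u * s) \<Longrightarrow> z \<in> genideal R {u, v}"
  shows "reflexive_module R (ideal_module R (genideal R {u, v}))"
proof -
  define J where "J = genideal R {u, v}"
  let ?D = "dual_module R (ideal_module R J)"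
  let ?ev = "\<lambda>w\<in>J. \<lambda>\<phi>\<in>carrier ?D. \<phi> w"
  have J: "ideal J R" and uJ: "u \<in> J"
    using ideal_pair[OF u(1) v] pair_mem[of u v] by (simp_all add: J_def)
  have lin: "(\<lambda>w\<in>J. \<phi> w + \<psi> w) \<in> carrier ?D" "(\<lambda>w\<in>J. c * \<phi> w) \<in> carrier ?D"
    if "\<phi> \<in> carrier ?D" "\<psi> \<in> carrier ?D" "c \<in> C" for \<phi> \<psi> c
    using that J
    by (auto simp: dual_ideal_iff module_hom_ideal_iff ideal_iff algebra_simps add_mem mult_mem)
  have D: "\<phi> w \<in> C" if "\<phi> \<in> carrier ?D" "w \<in> J" for \<phi> w
    using that by (auto simp: dual_ideal_iff module_hom_ideal_iff)
  have ev: "?ev w \<in> carrier (dual_module R ?D)" if "w \<in> J" for w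
    unfolding bidual_iff using that lin D zero_mem
    by (auto simp del: restrict_apply simp: restrict_apply')
  have "?ev \<in> module_hom R (ideal_module R J) (dual_module R ?D)"
  proof -
    have "?ev (w + w') = ?ev w \<oplus>\<^bsub>dual_module R ?D\<^esub> ?ev w'" if "w \<in> J" "w' \<in> J" for w w'
      using that J
      by (auto simp: fun_eq_iff dual_module_def[of _ ?D] ideal_iff dual_ideal_iff module_hom_ideal_iff)
    moreover have "?ev (r * w) = r \<odot>\<^bsub>dual_module R ?D\<^esub> ?ev w" if "r \<in> C" "w \<in> J" for r w
      using that J
      by (auto simp: fun_eq_iff dual_module_def[of _ ?D] ideal_iff dual_ideal_iff module_hom_ideal_iff)
    ultimately show ?thesis
      using ev by (simp add: module_hom_def ideal_module_def[of _ J] ring_module_def Pi_iff)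
  qed
  moreover have "inj_on ?ev J"
  proof (rule inj_onI)
    fix w w'
    assume w: "w \<in> J" "w' \<in> J" and "?ev w = ?ev w'"
    from this(3) have "?ev w (\<lambda>w\<in>J. w) = ?ev w' (\<lambda>w\<in>J. w)"
      by (rule arg_cong)
    with w inclusion_in_dual[OF J] show "w = w'"
      by simp
  qed
  moreover have "carrier (dual_module R ?D) \<subseteq> ?ev ` J"
  proof
    fix \<Phi>
    assume "\<Phi> \<in> carrier (dual_module R ?D)"
    note \<Phi> = this[unfolded bidual_iff]
    define z where "z = \<Phi> (\<lambda>w\<in>J. w)"
    have key: "u * \<Phi> \<phi> = \<phi> u * z" if \<phi>: "\<phi> \<in> carrier ?D" for \<phi>
    proof -
      have "(\<lambda>w\<in>J. u * \<phi> w) = (\<lambda>w\<in>J. \<phi> u * (\<lambda>w\<in>J. w) w)"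
        using dual_ideal_cross[OF J \<phi> uJ] by (auto simp: fun_eq_iff)
      then have "\<Phi> (\<lambda>w\<in>J. u * \<phi> w) = \<Phi> (\<lambda>w\<in>J. \<phi> u * (\<lambda>w\<in>J. w) w)"
        by (rule arg_cong)
      moreover have "\<Phi> (\<lambda>w\<in>J. u * \<phi> w) = u * \<Phi> \<phi>"
        using \<Phi> \<phi> u(1) by blast
      moreover have "\<Phi> (\<lambda>w\<in>J. \<phi> u * (\<lambda>w\<in>J. w) w) = \<phi> u * \<Phi> (\<lambda>w\<in>J. w)"
        using \<Phi> D[OF \<phi> uJ] inclusion_in_dual[OF J] by blast
      ultimately show ?thesis
        by (simp add: z_def)
    qed
    have "z \<in> J"
      unfolding J_def
    proof (rule dbl)
      show "z \<in> C"
        using \<Phi> inclusion_in_dual[OF J] by (auto simp: z_def)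
    next
      fix r
      assume "r \<in> colon R u v"
      then obtain s where r: "r \<in> C" and s: "s \<in> C" "r * v = u * s"
        by (auto simp: colon_iff)
      have ex: "\<exists>t\<in>C. r * w = u * t" if w: "w \<in> J" for w
      proof -
        obtain \<alpha> \<beta> where \<alpha>\<beta>: "\<alpha> \<in> C" "\<beta> \<in> C" "w = \<alpha> * u + \<beta> * v"
          using genideal_pair_mem[OF u(1) v] w unfolding J_def by metis
        have "r * w = u * (\<alpha> * r) + \<beta> * (r * v)"
          unfolding \<alpha>\<beta>(3) by (simp add: algebra_simps)
        also have "\<dots> = u * (\<alpha> * r + \<beta> * s)"
          unfolding s(2) by (simp add: algebra_simps)
        finally show ?thesis
          using \<alpha>\<beta> r s by (auto intro!: add_mem mult_mem)
      qed
      \<comment> \<open>Multiplication by \<open>r\<close> followed by division by \<open>u\<close> is the element of the dual of \<open>J\<close> that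
        corresponds to \<open>r\<close>.\<close>
      define t where "t w = (SOME t. t \<in> C \<and> r * w = u * t)" for w
      have t: "t w \<in> C" "r * w = u * t w" if "w \<in> J" for w
        using someI_ex[of "\<lambda>t. t \<in> C \<and> r * w = u * t"] ex[OF that] by (auto simp: t_def)
      have t_eq: "t w = y" if "w \<in> J" "r * w = u * y" for w y
        using t(2)[OF that(1)] that(2) u(2) by simp
      have "t (w + w') = t w + t w'" if "w \<in> J" "w' \<in> J" for w w'
        using that J t by (intro t_eq) (auto simp: ideal_iff distrib_left)
      moreover have "t (c * w) = c * t w" if "c \<in> C" "w \<in> J" for c w
        using that J t(2)[of w] by (intro t_eq) (auto simp: ideal_iff algebra_simps)
      ultimately have "restrict t J \<in> carrier ?D"
        using J t by (auto simp: dual_ideal_iff module_hom_ideal_iff ideal_iff)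
      from key[OF this] have "u * \<Phi> (restrict t J) = t u * z"
        using uJ by simp
      moreover have "t u = r"
        using uJ by (rule t_eq) (simp add: mult.commute)
      moreover have "\<Phi> (restrict t J) \<in> C"
        using \<Phi> \<open>restrict t J \<in> carrier ?D\<close> by blast
      ultimately show "\<exists>s\<in>C. r * z = u * s"
        by metis
    qed
    moreover have "\<Phi> = ?ev z"
    proof
      fix \<phi>
      show "\<Phi> \<phi> = ?ev z \<phi>"
      proof (cases "\<phi> \<in> carrier ?D")
        case True
        have "u * \<Phi> \<phi> = u * \<phi> z"
          using key[OF True] dual_ideal_cross[OF J True uJ \<open>z \<in> J\<close>] by simp
        with True \<open>z \<in> J\<close> u(2) show ?thesis
          by simp
      next
        case False
        with \<Phi> \<open>z \<in> J\<close> show ?thesis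
          by (simp add: extensional_def)
      qed
    qed
    ultimately show "\<Phi> \<in> ?ev ` J"
      by blast
  qed
  ultimately show ?thesis
    using ev unfolding reflexive_module_def module_iso_def bij_betw_def J_def[symmetric]
    by (auto simp: ideal_module_def[of _ J])
qed

end


section \<open>Monomial families in injective resolutions\<close>

text \<open>
  A ring \<open>B\<close> with a family of powers \<open>tpow s\<close>, for \<open>s\<close> in a monoid \<open>S\<close> of numbers. A \<open>B\<close>-module is only
  used through the action of these powers. In the explanations below, \<open>t ^ s\<close> stands for \<open>tpow s\<close>.
\<close>

locale monoid_action = B: cring B
  for B :: "'b ring" +
  fixes S :: "nat set" and tpow :: "nat \<Rightarrow> 'b"
  assumes zero_S: "0 \<in> S"
    and add_S: "s \<in> S \<Longrightarrow> s' \<in> S \<Longrightarrow> s + s' \<in> S"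
    and tpow_closed: "s \<in> S \<Longrightarrow> tpow s \<in> carrier B"
    and tpow_0: "tpow 0 = \<one>\<^bsub>B\<^esub>"
    and tpow_add: "s \<in> S \<Longrightarrow> s' \<in> S \<Longrightarrow> tpow (s + s') = tpow s \<otimes>\<^bsub>B\<^esub> tpow s'"
begin

definition semigroup_ideal :: "nat set \<Rightarrow> bool"
  where "semigroup_ideal T \<longleftrightarrow> T \<subseteq> S \<and> (\<forall>\<tau>\<in>T. \<forall>s\<in>S. \<tau> + s \<in> T)"

text \<open>
  Baer's criterion for the monomial ideal with exponent set \<open>T\<close>, relative to a submodule \<open>X\<close> of \<open>M\<close>:
  a linear map from the ideal to \<open>X\<close> is given by the images \<open>z \<tau>\<close> of the powers \<open>t ^ \<tau>\<close>, and it extends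
  to the whole ring precisely if it is multiplication by some \<open>f \<in> X\<close>. The submodule is given by its
  carrier because it will be a kernel or an image.
\<close>

definition extends :: "('b, 'c) module \<Rightarrow> 'c set \<Rightarrow> nat set \<Rightarrow> bool"
  where "extends M X T \<longleftrightarrow>
    (\<forall>z. (\<forall>\<tau>\<in>T. z \<tau> \<in> X) \<and> (\<forall>\<tau>\<in>T. \<forall>s\<in>S. tpow s \<odot>\<^bsub>M\<^esub> z \<tau> = z (\<tau> + s)) \<longrightarrow>
      (\<exists>f\<in>X. \<forall>\<tau>\<in>T. tpow \<tau> \<odot>\<^bsub>M\<^esub> f = z \<tau>))"

lemma extendsI:
  assumes "\<And>z. (\<And>\<tau>. \<tau> \<in> T \<Longrightarrow> z \<tau> \<in> X) \<Longrightarrow>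
      (\<And>\<tau> s. \<tau> \<in> T \<Longrightarrow> s \<in> S \<Longrightarrow> tpow s \<odot>\<^bsub>M\<^esub> z \<tau> = z (\<tau> + s)) \<Longrightarrow>
      \<exists>f\<in>X. \<forall>\<tau>\<in>T. tpow \<tau> \<odot>\<^bsub>M\<^esub> f = z \<tau>"
  shows "extends M X T"
  using assms by (auto simp: extends_def)

lemma extendsD:
  assumes "extends M X T" "\<And>\<tau>. \<tau> \<in> T \<Longrightarrow> z \<tau> \<in> X"
    "\<And>\<tau> s. \<tau> \<in> T \<Longrightarrow> s \<in> S \<Longrightarrow> tpow s \<odot>\<^bsub>M\<^esub> z \<tau> = z (\<tau> + s)"
  shows "\<exists>f\<in>X. \<forall>\<tau>\<in>T. tpow \<tau> \<odot>\<^bsub>M\<^esub> f = z \<tau>"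
  using assms unfolding extends_def by simp

lemma tpow_action:
  "Module.module B M \<Longrightarrow> s \<in> S \<Longrightarrow> s' \<in> S \<Longrightarrow> v \<in> carrier M \<Longrightarrow>
    tpow s \<odot>\<^bsub>M\<^esub> (tpow s' \<odot>\<^bsub>M\<^esub> v) = tpow (s + s') \<odot>\<^bsub>M\<^esub> v"
  by (simp add: module.smult_assoc1 tpow_add tpow_closed)

text \<open>
  In a semigroup ring these are the exponents \<open>g\<close> for which \<open>t ^ g\<close> is a nonzero element of the socle of
  \<open>R / t ^ a R\<close>; equivalently, \<open>g - a\<close> is a pseudo-Frobenius number of \<open>S\<close>.
\<close>

definition socle_degree :: "nat \<Rightarrow> nat \<Rightarrow> bool"
  where "socle_degree a g \<longleftrightarrow> g \<in> S \<and> g \<notin> (+) a ` S \<and> (\<forall>s\<in>S - {0}. g + s \<in> (+) a ` S)"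

lemma semigroup_ideal_shift: "a \<in> S \<Longrightarrow> semigroup_ideal ((+) a ` S)"
  unfolding semigroup_ideal_def using add_S by (auto simp: add.assoc)

lemma semigroup_ideal_socle:
  assumes "a \<in> S" "socle_degree a g"
  shows "semigroup_ideal (insert g ((+) a ` S))"
proof -
  have "g + s \<in> insert g ((+) a ` S)" if "s \<in> S" for s
    using assms that by (cases "s = 0") (auto simp: socle_degree_def)
  with semigroup_ideal_shift[OF assms(1)] assms(2) show ?thesis
    by (auto simp: semigroup_ideal_def socle_degree_def)
qed

lemma semigroup_ideal_maximal: "semigroup_ideal (S - {0})"
  using add_S by (auto simp: semigroup_ideal_def)

text \<open>
  The family that is \<open>y\<close> at \<open>g\<close> and zero on \<open>a + S\<close> is compatible, because multiplying by a positive
  power of \<open>t\<close> kills \<open>y\<close> and moves \<open>g\<close> into \<open>a + S\<close>. So \<open>Hom(B / t ^ a, X) \<rightarrow> Hom(k, X)\<close>, induced by the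
  socle element \<open>t ^ g\<close>, is surjective.
\<close>

lemma extends_socle:
  assumes M: "Module.module B M" and X: "X \<subseteq> carrier M" "\<zero>\<^bsub>M\<^esub> \<in> X"
    and a: "a \<in> S" and g: "socle_degree a g"
    and ext: "extends M X (insert g ((+) a ` S))"
    and y: "y \<in> X" "\<And>s. s \<in> S - {0} \<Longrightarrow> tpow s \<odot>\<^bsub>M\<^esub> y = \<zero>\<^bsub>M\<^esub>"
  shows "\<exists>f\<in>X. tpow a \<odot>\<^bsub>M\<^esub> f = \<zero>\<^bsub>M\<^esub> \<and> tpow g \<odot>\<^bsub>M\<^esub> f = y"
proof -
  let ?z = "\<lambda>\<tau>. if \<tau> = g then y else \<zero>\<^bsub>M\<^esub>"
  have ga: "g \<notin> (+) a ` S"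
    using g by (simp add: socle_degree_def)
  have "tpow s \<odot>\<^bsub>M\<^esub> ?z \<tau> = ?z (\<tau> + s)" if \<tau>: "\<tau> \<in> insert g ((+) a ` S)" and s: "s \<in> S" for \<tau> s
  proof (cases "\<tau> = g")
    case True
    with s y X M show ?thesis
      by (cases "s = 0") (auto simp: tpow_0 module.smult_one)
  next
    case False
    then have "\<tau> + s \<in> (+) a ` S"
      using \<tau> s add_S by (auto simp: add.assoc)
    with ga have "\<tau> + s \<noteq> g"
      by metis
    with False show ?thesis
      using M s tpow_closed by (auto simp: module.smult_r_null)
  qed
  then have "\<exists>f\<in>X. \<forall>\<tau>\<in>insert g ((+) a ` S). tpow \<tau> \<odot>\<^bsub>M\<^esub> f = ?z \<tau>"
    by (intro extendsD[OF ext]) (use X y in auto)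
  then obtain f where f: "f \<in> X" "\<forall>\<tau>\<in>insert g ((+) a ` S). tpow \<tau> \<odot>\<^bsub>M\<^esub> f = ?z \<tau>"
    by blast
  have "a \<in> (+) a ` S"
    using zero_S by force
  with ga have "a \<noteq> g" "a \<in> insert g ((+) a ` S)"
    by auto
  with f(2) have "tpow a \<odot>\<^bsub>M\<^esub> f = \<zero>\<^bsub>M\<^esub>" "tpow g \<odot>\<^bsub>M\<^esub> f = y"
    by (metis, metis insertI1)
  with f(1) show ?thesis
    by blast
qed

text \<open>
  This is the vanishing of \<open>Ext\<^sup>1(k, X)\<close> for the kernel \<open>X\<close> of \<open>d\<close>. A family \<open>z\<close> in \<open>X\<close> is induced by some
  \<open>e\<close> in \<open>M\<close>, and \<open>d e\<close> is a socle element of the image. It has to be shown that \<open>d e\<close> is the image of a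
  socle element of \<open>M\<close>, which then corrects \<open>e\<close> to an element of \<open>X\<close>. Write \<open>d e = t ^ g y\<close> with
  \<open>t ^ a y = 0\<close>; by divisibility of \<open>X\<close> there is a preimage \<open>e2\<close> of \<open>y\<close> with \<open>t ^ a e2 = 0\<close>, and
  \<open>t ^ g e2\<close> is the desired socle element.
\<close>

lemma extends_kernel_maximal:
  assumes M: "Module.module B M" and N: "Module.module B N"
    and d: "d \<in> module_hom B M N"
    and X: "X = {v \<in> carrier M. d v = \<zero>\<^bsub>N\<^esub>}"
    and a: "a \<in> S - {0}" and g: "socle_degree a g"
    and M_ext: "extends M (carrier M) (S - {0})"
    and N_ext: "extends N (d ` carrier M) (insert g ((+) a ` S))"
    and div: "\<And>v. v \<in> X \<Longrightarrow> \<exists>w\<in>X. tpow a \<odot>\<^bsub>M\<^esub> w = v"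
  shows "extends M X (S - {0})"
proof (rule extendsI)
  interpret M: module B M by (rule M)
  interpret N: module B N by (rule N)
  have d_closed: "d v \<in> carrier N" if "v \<in> carrier M" for v
    using d that by (auto simp: module_hom_def)
  have d_add: "d (v \<oplus>\<^bsub>M\<^esub> w) = d v \<oplus>\<^bsub>N\<^esub> d w" if "v \<in> carrier M" "w \<in> carrier M" for v w
    using d that by (auto simp: module_hom_def)
  have d_tpow: "d (tpow s \<odot>\<^bsub>M\<^esub> v) = tpow s \<odot>\<^bsub>N\<^esub> d v" if "v \<in> carrier M" "s \<in> S" for v s
    using d that tpow_closed by (auto simp: module_hom_def)
  have d_zero: "d \<zero>\<^bsub>M\<^esub> = \<zero>\<^bsub>N\<^esub>"
    using d_add[of "\<zero>\<^bsub>M\<^esub>" "\<zero>\<^bsub>M\<^esub>"] d_closed[of "\<zero>\<^bsub>M\<^esub>"] by (simp add: N.add.l_cancel_one')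
  have d_neg: "d (\<ominus>\<^bsub>M\<^esub> v) = \<ominus>\<^bsub>N\<^esub> d v" if "v \<in> carrier M" for v
    using d_add[of "\<ominus>\<^bsub>M\<^esub> v" v] that d_closed d_zero by (simp add: M.l_neg N.minus_equality)
  have minus: "tpow s \<odot>\<^bsub>M\<^esub> (v \<ominus>\<^bsub>M\<^esub> w) = tpow s \<odot>\<^bsub>M\<^esub> v \<ominus>\<^bsub>M\<^esub> tpow s \<odot>\<^bsub>M\<^esub> w"
    if "v \<in> carrier M" "w \<in> carrier M" "s \<in> S" for v w s
    using that tpow_closed by (simp add: a_minus_def M.smult_r_distr M.smult_r_minus)
  have d_minus: "d (v \<ominus>\<^bsub>M\<^esub> w) = d v \<ominus>\<^bsub>N\<^esub> d w" if "v \<in> carrier M" "w \<in> carrier M" for v w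
    using that by (simp add: a_minus_def d_add d_neg)
  have aS: "a \<in> S" "a \<noteq> 0"
    using a by simp_all
  have gS: "g \<in> S"
    using g by (simp add: socle_degree_def)
  fix z
  assume z: "\<And>\<tau>. \<tau> \<in> S - {0} \<Longrightarrow> z \<tau> \<in> X"
    and z_tpow: "\<And>\<tau> s. \<tau> \<in> S - {0} \<Longrightarrow> s \<in> S \<Longrightarrow> tpow s \<odot>\<^bsub>M\<^esub> z \<tau> = z (\<tau> + s)"
  have "\<exists>e\<in>carrier M. \<forall>\<tau>\<in>S - {0}. tpow \<tau> \<odot>\<^bsub>M\<^esub> e = z \<tau>"
    by (rule extendsD[OF M_ext _ z_tpow]) (use z X in auto)
  then obtain e where e: "e \<in> carrier M" "\<And>\<tau>. \<tau> \<in> S - {0} \<Longrightarrow> tpow \<tau> \<odot>\<^bsub>M\<^esub> e = z \<tau>"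
    by blast
  have "tpow s \<odot>\<^bsub>N\<^esub> d e = \<zero>\<^bsub>N\<^esub>" if "s \<in> S - {0}" for s
    using e z[OF that] d_tpow[OF e(1), of s] that X by auto
  moreover have "\<zero>\<^bsub>N\<^esub> \<in> d ` carrier M"
    using d_zero M.zero_closed by (metis imageI)
  ultimately have "\<exists>y\<in>d ` carrier M. tpow a \<odot>\<^bsub>N\<^esub> y = \<zero>\<^bsub>N\<^esub> \<and> tpow g \<odot>\<^bsub>N\<^esub> y = d e"
    using d_closed e(1) by (intro extends_socle[OF N _ _ aS(1) g N_ext]) auto
  then obtain y where y: "y \<in> d ` carrier M" "tpow a \<odot>\<^bsub>N\<^esub> y = \<zero>\<^bsub>N\<^esub>" "tpow g \<odot>\<^bsub>N\<^esub> y = d e"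
    by blast
  from y(1) obtain e1 where e1: "e1 \<in> carrier M" "y = d e1"
    by auto
  have "tpow a \<odot>\<^bsub>M\<^esub> e1 \<in> X"
    using e1 y(2) d_tpow aS tpow_closed X by auto
  with div obtain v where v: "v \<in> X" "tpow a \<odot>\<^bsub>M\<^esub> v = tpow a \<odot>\<^bsub>M\<^esub> e1"
    by blast
  then have vM: "v \<in> carrier M" "d v = \<zero>\<^bsub>N\<^esub>"
    using X by auto
  define e2 where "e2 = e1 \<ominus>\<^bsub>M\<^esub> v"
  have e2: "e2 \<in> carrier M"
    using e1 vM by (simp add: e2_def)
  have a_e2: "tpow a \<odot>\<^bsub>M\<^esub> e2 = \<zero>\<^bsub>M\<^esub>"
    unfolding e2_def minus[OF e1(1) vM(1) aS(1)] v(2)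
    using e1 aS tpow_closed by (simp add: a_minus_def M.r_neg)
  have d_e2: "d e2 = y"
    using e1 vM d_closed[OF e1(1)] unfolding e2_def d_minus[OF e1(1) vM(1)] by (simp add: a_minus_def)
  have soc: "tpow \<tau> \<odot>\<^bsub>M\<^esub> (tpow g \<odot>\<^bsub>M\<^esub> e2) = \<zero>\<^bsub>M\<^esub>" if \<tau>: "\<tau> \<in> S - {0}" for \<tau>
  proof -
    obtain s where s: "s \<in> S" "\<tau> + g = s + a"
      using g \<tau> unfolding socle_degree_def by (metis add.commute imageE)
    have "tpow \<tau> \<odot>\<^bsub>M\<^esub> (tpow g \<odot>\<^bsub>M\<^esub> e2) = tpow (s + a) \<odot>\<^bsub>M\<^esub> e2"
      using tpow_action[OF M _ gS e2, of \<tau>] \<tau> s by simp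
    also have "\<dots> = tpow s \<odot>\<^bsub>M\<^esub> (tpow a \<odot>\<^bsub>M\<^esub> e2)"
      using tpow_action[OF M s(1) aS(1) e2] by simp
    finally show ?thesis
      using a_e2 s(1) tpow_closed by simp
  qed
  define f where "f = e \<ominus>\<^bsub>M\<^esub> tpow g \<odot>\<^bsub>M\<^esub> e2"
  have ge2: "tpow g \<odot>\<^bsub>M\<^esub> e2 \<in> carrier M"
    using e2 gS tpow_closed by simp
  have "d f = d e \<ominus>\<^bsub>N\<^esub> d e"
    unfolding f_def d_minus[OF e(1) ge2] d_tpow[OF e2 gS] d_e2 y(3) ..
  then have "f \<in> X"
    using X e ge2 d_closed[OF e(1)] by (simp add: f_def a_minus_def N.r_neg)
  moreover have "tpow \<tau> \<odot>\<^bsub>M\<^esub> f = z \<tau>" if \<tau>: "\<tau> \<in> S - {0}" for \<tau>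
  proof -
    have "tpow \<tau> \<odot>\<^bsub>M\<^esub> f = z \<tau> \<ominus>\<^bsub>M\<^esub> \<zero>\<^bsub>M\<^esub>"
      unfolding f_def using minus[OF e(1) ge2] \<tau> soc e(2) by simp
    then show ?thesis
      using z[OF \<tau>] X by (simp add: a_minus_def)
  qed
  ultimately show "\<exists>f\<in>X. \<forall>\<tau>\<in>S - {0}. tpow \<tau> \<odot>\<^bsub>M\<^esub> f = z \<tau>"
    by blast
qed

text \<open>
  If \<open>v\<close> is the largest element of \<open>S - T\<close>, then \<open>v + s \<in> T\<close> for all positive \<open>s \<in> S\<close>, so the
  ideals of \<open>T\<close> and \<open>T \<union> {v}\<close> differ by a copy of \<open>k\<close>. The hypothesis, applied to the shifted family
  \<open>s \<mapsto> z (v + s)\<close>, supplies the missing value at \<open>v\<close>.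
\<close>

lemma extends_cofinite:
  assumes M: "Module.module B M" and X: "X \<subseteq> carrier M"
    and ext: "extends M X (S - {0})"
    and "semigroup_ideal T" "finite (S - T)"
  shows "extends M X T"
  using assms(4,5)
proof (induction "card (S - T)" arbitrary: T)
  case 0
  then have "S \<subseteq> T"
    by auto
  show ?case
  proof (rule extendsI)
    fix z
    assume "\<And>\<tau>. \<tau> \<in> T \<Longrightarrow> z \<tau> \<in> X"
      "\<And>\<tau> s. \<tau> \<in> T \<Longrightarrow> s \<in> S \<Longrightarrow> tpow s \<odot>\<^bsub>M\<^esub> z \<tau> = z (\<tau> + s)"
    with \<open>S \<subseteq> T\<close> zero_S \<open>semigroup_ideal T\<close> show "\<exists>f\<in>X. \<forall>\<tau>\<in>T. tpow \<tau> \<odot>\<^bsub>M\<^esub> f = z \<tau>"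
      by (intro bexI[of _ "z 0"]) (auto simp: semigroup_ideal_def)
  qed
next
  case (Suc k)
  define v where "v = Max (S - T)"
  have ne: "S - T \<noteq> {}"
    using Suc.hyps(2) by (metis card.empty nat.distinct(1))
  have v: "v \<in> S" "v \<notin> T"
    using Max_in[OF Suc.prems(2) ne] by (auto simp: v_def)
  have beyond: "v + s \<in> T" if "s \<in> S - {0}" for s
    using Max_ge[OF Suc.prems(2), of "v + s"] that v(1) add_S unfolding v_def[symmetric] by force
  have step: "v + s \<in> insert v T" if "s \<in> S" for s
    using beyond that by (cases "s = 0") auto
  have "S - insert v T = (S - T) - {v}"
    by auto
  then have "k = card (S - insert v T)"
    using Suc.hyps(2) Suc.prems(2) v by simp
  moreover have "semigroup_ideal (insert v T)"
    using Suc.prems(1) v step by (auto simp: semigroup_ideal_def)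
  ultimately have IH: "extends M X (insert v T)"
    using Suc.hyps(1) Suc.prems(2) by simp
  show ?case
  proof (rule extendsI)
    fix z
    assume z: "\<And>\<tau>. \<tau> \<in> T \<Longrightarrow> z \<tau> \<in> X"
      and z_tpow: "\<And>\<tau> s. \<tau> \<in> T \<Longrightarrow> s \<in> S \<Longrightarrow> tpow s \<odot>\<^bsub>M\<^esub> z \<tau> = z (\<tau> + s)"
    have "\<exists>f\<in>X. \<forall>s\<in>S - {0}. tpow s \<odot>\<^bsub>M\<^esub> f = z (v + s)"
      by (rule extendsD[OF ext]) (simp_all add: z z_tpow beyond add.assoc[symmetric])
    then obtain f where f: "f \<in> X" "\<And>s. s \<in> S - {0} \<Longrightarrow> tpow s \<odot>\<^bsub>M\<^esub> f = z (v + s)"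
      by blast
    define z' where "z' = z(v := f)"
    have "z' \<tau> \<in> X" if "\<tau> \<in> insert v T" for \<tau>
      using that z f by (auto simp: z'_def)
    moreover have "tpow s \<odot>\<^bsub>M\<^esub> z' \<tau> = z' (\<tau> + s)" if \<tau>: "\<tau> \<in> insert v T" and s: "s \<in> S" for \<tau> s
    proof (cases "\<tau> = v")
      case True
      show ?thesis
      proof (cases "s = 0")
        case True
        have "tpow 0 \<odot>\<^bsub>M\<^esub> f = f"
          using f(1) X M by (auto simp: tpow_0 module.smult_one)
        with \<open>\<tau> = v\<close> True show ?thesis
          by (simp add: z'_def)
      next
        case False
        with f(2) s \<open>\<tau> = v\<close> show ?thesis
          by (simp add: z'_def)
      qed
    next
      case False
      then have "\<tau> \<in> T" "\<tau> + s \<in> T"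
        using \<tau> s Suc.prems(1) by (auto simp: semigroup_ideal_def)
      then have "\<tau> + s \<noteq> v"
        using v by auto
      with False z_tpow \<open>\<tau> \<in> T\<close> s show ?thesis
        by (simp add: z'_def)
    qed
    ultimately have "\<exists>h\<in>X. \<forall>\<tau>\<in>insert v T. tpow \<tau> \<odot>\<^bsub>M\<^esub> h = z' \<tau>"
      by (rule extendsD[OF IH])
    then obtain h where h: "h \<in> X" "\<And>\<tau>. \<tau> \<in> insert v T \<Longrightarrow> tpow \<tau> \<odot>\<^bsub>M\<^esub> h = z' \<tau>"
      by blast
    have "tpow \<tau> \<odot>\<^bsub>M\<^esub> h = z \<tau>" if "\<tau> \<in> T" for \<tau>
      using h(2)[of \<tau>] that v by (auto simp: z'_def)
    with h show "\<exists>f\<in>X. \<forall>\<tau>\<in>T. tpow \<tau> \<odot>\<^bsub>M\<^esub> f = z \<tau>"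
      by blast
  qed
qed

text \<open>
  Division by \<open>t ^ a\<close> is the extension of the map \<open>t ^ (a + s) \<mapsto> t ^ s v\<close> from the principal ideal \<open>(t ^ a)\<close>.
\<close>

lemma extends_divisible:
  assumes M: "Module.module B M" and a: "a \<in> S"
    and ext: "extends M (carrier M) ((+) a ` S)" and v: "v \<in> carrier M"
  obtains w where "w \<in> carrier M" "tpow a \<odot>\<^bsub>M\<^esub> w = v"
proof -
  have "tpow (\<tau> - a) \<odot>\<^bsub>M\<^esub> v \<in> carrier M" if "\<tau> \<in> (+) a ` S" for \<tau>
    using that v M tpow_closed by (auto simp: module.smult_closed)
  moreover have "tpow s \<odot>\<^bsub>M\<^esub> (tpow (\<tau> - a) \<odot>\<^bsub>M\<^esub> v) = tpow (\<tau> + s - a) \<odot>\<^bsub>M\<^esub> v"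
    if "\<tau> \<in> (+) a ` S" "s \<in> S" for \<tau> s
    using that v by (auto simp: tpow_action[OF M] add.commute add.left_commute)
  ultimately have "\<exists>w\<in>carrier M. \<forall>\<tau>\<in>(+) a ` S. tpow \<tau> \<odot>\<^bsub>M\<^esub> w = tpow (\<tau> - a) \<odot>\<^bsub>M\<^esub> v"
    by (rule extendsD[OF ext])
  then obtain w where w: "w \<in> carrier M"
    "\<And>\<tau>. \<tau> \<in> (+) a ` S \<Longrightarrow> tpow \<tau> \<odot>\<^bsub>M\<^esub> w = tpow (\<tau> - a) \<odot>\<^bsub>M\<^esub> v"
    by blast
  have "a \<in> (+) a ` S"
    using zero_S by force
  from w(2)[OF this] have "tpow a \<odot>\<^bsub>M\<^esub> w = v"
    using v M by (simp add: tpow_0 module.smult_one)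
  with w(1) show thesis
    by (rule that)
qed


lemma finite_minus_semigroup_ideal:
  "finite (S - (+) a ` S) \<Longrightarrow> finite (S - insert g ((+) a ` S))"
  by (rule finite_subset[rotated]) auto

text \<open>
  Beyond the length \<open>s\<close> of the resolution the images are zero. Going down, \<open>d (i + 1)\<close> maps \<open>E (i + 1)\<close>
  onto a module for which the claim is already known, and its kernel is the image of \<open>E i\<close>, hence
  divisible by \<open>t ^ a\<close>. Divisibility is what restricts the claim to images of differentials: it fails
  for \<open>B\<close>, the kernel of \<open>d 0\<close>.
\<close>

lemma extends_cocycles:
  fixes E :: "nat \<Rightarrow> ('b, 'c) module"
  assumes E: "\<And>i. Module.module B (E i)"
    and d: "\<And>i. d i \<in> module_hom B (E i) (E (Suc i))"
    and exact: "\<And>i. d i ` carrier (E i) = {v \<in> carrier (E (Suc i)). d (Suc i) v = \<zero>\<^bsub>E (Suc (Suc i))\<^esub>}"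
    and bound: "\<And>i. s < i \<Longrightarrow> carrier (E i) = {\<zero>\<^bsub>E i\<^esub>}"
    and ext: "\<And>i T. semigroup_ideal T \<Longrightarrow> extends (E i) (carrier (E i)) T"
    and a: "a \<in> S - {0}" "finite (S - (+) a ` S)" and g: "socle_degree a g"
    and T: "semigroup_ideal T" "finite (S - T)"
  shows "extends (E (Suc i)) (d i ` carrier (E i)) T"
  using T
proof (induction "s - i" arbitrary: i T)
  case 0
  interpret M: module B "E (Suc i)" by (rule E)
  have "d i v = \<zero>\<^bsub>E (Suc i)\<^esub>" if "v \<in> carrier (E i)" for v
    using d[of i] that bound[of "Suc i"] 0 by (auto simp: module_hom_def Pi_iff)
  moreover have "carrier (E i) \<noteq> {}"
    using module.axioms(2)[OF E[of i]] abelian_groupE(2) by blast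
  ultimately have im: "d i ` carrier (E i) = {\<zero>\<^bsub>E (Suc i)\<^esub>}"
    by auto
  have "T \<subseteq> S"
    using 0 by (simp add: semigroup_ideal_def)
  then show ?case
    unfolding im using tpow_closed by (intro extendsI) (auto simp: subset_iff)
next
  case (Suc k)
  let ?X = "{v \<in> carrier (E (Suc i)). d (Suc i) v = \<zero>\<^bsub>E (Suc (Suc i))\<^esub>}"
  have aS: "a \<in> S"
    using a by simp
  interpret M: module B "E (Suc i)" by (rule E)
  have "extends (E (Suc i)) ?X (S - {0})"
  proof (rule extends_kernel_maximal[OF E E d refl a(1) g])
    show "extends (E (Suc i)) (carrier (E (Suc i))) (S - {0})"
      by (rule ext[OF semigroup_ideal_maximal])
    show "extends (E (Suc (Suc i))) (d (Suc i) ` carrier (E (Suc i))) (insert g ((+) a ` S))"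
      using Suc.hyps a(2)
      by (intro Suc.hyps(1) semigroup_ideal_socle[OF aS g] finite_minus_semigroup_ideal) auto
  next
    fix v
    assume "v \<in> ?X"
    then obtain e where e: "e \<in> carrier (E i)" "v = d i e"
      unfolding exact[of i, symmetric] by blast
    obtain w where w: "w \<in> carrier (E i)" "tpow a \<odot>\<^bsub>E i\<^esub> w = e"
      using extends_divisible[OF E aS ext[OF semigroup_ideal_shift[OF aS]] e(1)] .
    have "tpow a \<odot>\<^bsub>E (Suc i)\<^esub> d i w = v"
      using d[of i] w e aS tpow_closed by (auto simp: module_hom_def)
    moreover have "d i w \<in> ?X"
      unfolding exact[of i, symmetric] using w(1) by (rule imageI)
    ultimately show "\<exists>w\<in>?X. tpow a \<odot>\<^bsub>E (Suc i)\<^esub> w = v"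
      by blast
  qed
  from extends_cofinite[OF E _ this Suc.prems] show ?case
    unfolding exact[of i] by auto
qed

end


section \<open>Semigroup rings and their localization at the origin\<close>

definition supported :: "nat set \<Rightarrow> 'k::field poly set"
  where "supported T = {p. \<forall>e. Polynomial.coeff p e \<noteq> 0 \<longrightarrow> e \<in> T}"

lemma supported_monom [simp]: "Polynomial.monom c \<tau> \<in> supported T \<longleftrightarrow> c = 0 \<or> \<tau> \<in> T"
  by (auto simp: supported_def)

lemma supported_zero [simp]: "0 \<in> supported T"
  by (simp add: supported_def)

lemma supported_add: "p \<in> supported T \<Longrightarrow> q \<in> supported T \<Longrightarrow> p + q \<in> supported T"
  by (auto simp: supported_def) (metis add.right_neutral)

lemma supported_sum: "(\<And>i. i \<in> K \<Longrightarrow> f i \<in> supported T) \<Longrightarrow> sum f K \<in> supported T"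
  by (induction K rule: infinite_finite_induct) (auto simp: supported_add)

lemma supported_mult:
  assumes "p \<in> supported S" "q \<in> supported T" "\<And>s \<tau>. s \<in> S \<Longrightarrow> \<tau> \<in> T \<Longrightarrow> s + \<tau> \<in> T"
  shows "p * q \<in> supported T"
  unfolding supported_def
proof (intro CollectI allI impI)
  fix e
  assume "Polynomial.coeff (p * q) e \<noteq> 0"
  then obtain i where "i \<le> e" "Polynomial.coeff p i * Polynomial.coeff q (e - i) \<noteq> 0"
    unfolding coeff_mult by (metis (no_types, lifting) atMost_iff sum.neutral)
  then have "i \<in> S" "e - i \<in> T"
    using assms(1,2) by (auto simp: supported_def)
  from assms(3)[OF this] \<open>i \<le> e\<close> show "e \<in> T"
    by simp
qed

lemma supported_induct [consumes 1, case_names zero monom add]: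
  assumes p: "p \<in> supported T" and zero: "P 0"
    and monom: "\<And>c \<tau>. \<tau> \<in> T \<Longrightarrow> P (Polynomial.monom c \<tau>)"
    and add: "\<And>p q. p \<in> supported T \<Longrightarrow> q \<in> supported T \<Longrightarrow> P p \<Longrightarrow> P q \<Longrightarrow> P (p + q)"
  shows "P p"
proof -
  have "P (\<Sum>i\<in>K. Polynomial.monom (Polynomial.coeff p i) i)" if "finite K" for K
    using that
  proof (induction K rule: finite_induct)
    case (insert i K)
    have "(\<Sum>i\<in>K. Polynomial.monom (Polynomial.coeff p i) i) \<in> supported T"
      using p by (intro supported_sum) (auto simp: supported_def)
    moreover have "P (Polynomial.monom (Polynomial.coeff p i) i)"
      using p monom zero by (cases "Polynomial.coeff p i = 0") (auto simp: supported_def)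
    moreover have "Polynomial.monom (Polynomial.coeff p i) i \<in> supported T"
      using p by (auto simp: supported_def)
    ultimately show ?case
      using insert add by simp
  qed (simp add: zero)
  from this[of "{..degree p}"] show ?thesis
    by (simp add: poly_as_sum_of_monoms)
qed

locale numerical_semigroup_ring =
  fixes S :: "nat set" and K :: "'k::field itself"
  assumes zero_S: "0 \<in> S"
    and add_S: "s \<in> S \<Longrightarrow> s' \<in> S \<Longrightarrow> s + s' \<in> S"
    and cofinite_S: "finite (- S)"
begin

abbreviation C :: "'k poly set"
  where "C \<equiv> supported S"

text \<open>
  The complement in \<open>R\<close> of the maximal ideal of polynomials without constant term.
\<close>

definition units_at_origin :: "'k poly set"
  where "units_at_origin = {w \<in> C. Polynomial.coeff w 0 \<noteq> 0}"

definition fractions :: "'k poly set \<Rightarrow> 'k poly fract set"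
  where "fractions X = {Fract p w | p w. p \<in> X \<and> w \<in> units_at_origin}"

lemma supported_uminus: "p \<in> C \<Longrightarrow> - p \<in> C"
  by (simp add: supported_def)

sublocale R: domain_subring C
proof
  show "1 \<in> C"
    using supported_monom[of 1 0 S] zero_S by simp
qed (auto simp: supported_add supported_uminus supported_mult add_S)

lemma one_unit: "1 \<in> units_at_origin"
  by (simp add: units_at_origin_def R.one_mem)

lemma mult_unit: "w \<in> units_at_origin \<Longrightarrow> w' \<in> units_at_origin \<Longrightarrow> w * w' \<in> units_at_origin"
  by (simp add: units_at_origin_def R.mult_mem coeff_mult_0)

lemma unit_nonzero: "w \<in> units_at_origin \<Longrightarrow> w \<noteq> 0"
  by (auto simp: units_at_origin_def)

lemma unit_C: "w \<in> units_at_origin \<Longrightarrow> w \<in> C"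
  by (simp add: units_at_origin_def)

lemma fractionsI: "p \<in> X \<Longrightarrow> w \<in> units_at_origin \<Longrightarrow> Fract p w \<in> fractions X"
  by (auto simp: fractions_def)

lemma fractionsE:
  assumes "q \<in> fractions X"
  obtains p w where "p \<in> X" "w \<in> units_at_origin" "q = Fract p w"
  using assms by (auto simp: fractions_def)

sublocale L: domain_subring "fractions C"
proof
  show "0 \<in> fractions C" "1 \<in> fractions C"
    unfolding Zero_fract_def One_fract_def by (intro fractionsI one_unit R.zero_mem R.one_mem)+
  fix q q'
  assume "q \<in> fractions C"
  then obtain p w where p: "p \<in> C" "w \<in> units_at_origin" "q = Fract p w"
    by (rule fractionsE)
  then show "- q \<in> fractions C"
    by (auto intro: fractionsI R.uminus_mem)
  assume "q' \<in> fractions C"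
  then obtain p' w' where "p' \<in> C" "w' \<in> units_at_origin" "q' = Fract p' w'"
    by (rule fractionsE)
  with p show "q + q' \<in> fractions C" "q * q' \<in> fractions C"
    by (auto simp: unit_nonzero unit_C intro!: fractionsI mult_unit R.add_mem R.mult_mem)
qed

definition tpow :: "nat \<Rightarrow> 'k poly fract"
  where "tpow s = Fract (Polynomial.monom 1 s) 1"

sublocale act: monoid_action L.R S tpow
proof
  show "0 \<in> S" by (rule zero_S)
  show "tpow 0 = \<one>\<^bsub>L.R\<^esub>"
    by (simp add: tpow_def One_fract_def)
  fix s s'
  assume "s \<in> S"
  then show "tpow s \<in> carrier L.R"
    by (simp add: tpow_def fractionsI one_unit)
  assume "s' \<in> S"
  with \<open>s \<in> S\<close> show "s + s' \<in> S"
    by (rule add_S)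
  show "tpow (s + s') = tpow s \<otimes>\<^bsub>L.R\<^esub> tpow s'"
    by (simp add: tpow_def mult_monom)
qed

end


section \<open>Injective modules over the localization\<close>

context numerical_semigroup_ring
begin

lemma supported_ideal_mult:
  "act.semigroup_ideal T \<Longrightarrow> r \<in> C \<Longrightarrow> p \<in> supported T \<Longrightarrow> r * p \<in> supported T"
  by (erule supported_mult, assumption) (metis act.semigroup_ideal_def add.commute)

lemma supported_mono: "T \<subseteq> T' \<Longrightarrow> supported T \<subseteq> supported T'"
  by (auto simp: supported_def)

lemma ideal_fractions:
  assumes "act.semigroup_ideal T"
  shows "ideal (fractions (supported T)) L.R"
  unfolding L.ideal_iff
proof (intro conjI ballI)
  have T: "supported T \<subseteq> C"
    using assms by (intro supported_mono) (simp add: act.semigroup_ideal_def)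
  then show "fractions (supported T) \<subseteq> fractions C"
    by (auto simp: fractions_def)
  show "0 \<in> fractions (supported T)"
    unfolding Zero_fract_def by (intro fractionsI one_unit) simp
  note mult = supported_ideal_mult[OF assms]
  fix q q'
  assume "q' \<in> fractions (supported T)"
  then obtain p' w' where q': "p' \<in> supported T" "w' \<in> units_at_origin" "q' = Fract p' w'"
    by (rule fractionsE)
  {
    assume "q \<in> fractions (supported T)"
    then obtain p w where "p \<in> supported T" "w \<in> units_at_origin" "q = Fract p w"
      by (rule fractionsE)
    moreover from this q' have "p * w' + p' * w \<in> supported T"
      using mult[of w' p] mult[of w p'] by (simp add: supported_add unit_C mult.commute)
    ultimately show "q + q' \<in> fractions (supported T)"
      using q' by (auto simp: unit_nonzero intro!: fractionsI mult_unit)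
  }
  {
    assume "q \<in> fractions C"
    then obtain p w where "p \<in> C" "w \<in> units_at_origin" "q = Fract p w"
      by (rule fractionsE)
    with q' show "q * q' \<in> fractions (supported T)"
      by (auto intro!: fractionsI mult mult_unit)
  }
qed

text \<open>
  A compatible family defines the \<open>R\<close>-linear map \<open>h p = (\<Sum>\<tau>. p\<^sub>\<tau> z \<tau>)\<close> on the polynomials supported on \<open>T\<close>, and
  \<open>g (p / w) = h p / w\<close> is its extension to the ideal of \<open>B\<close> that they generate. Injectivity extends \<open>g\<close>
  to \<open>B\<close>, and the value at 1 induces the family.
\<close>

lemma injective_extends:
  fixes E :: "('k poly fract, 'u) module"
  assumes inj: "injective_module L.R E" and T: "act.semigroup_ideal T"
  shows "act.extends E (carrier E) T"
proof (rule act.extendsI)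
  interpret E: module L.R E
    using inj by (simp add: injective_module_def)
  note [simp del] = eq_fract
  have assoc: "a \<odot>\<^bsub>E\<^esub> (b \<odot>\<^bsub>E\<^esub> v) = (a * b) \<odot>\<^bsub>E\<^esub> v"
    if "a \<in> fractions C" "b \<in> fractions C" "v \<in> carrier E" for a b v
    using E.smult_assoc1[of a b v] that by simp
  have distr: "(a + b) \<odot>\<^bsub>E\<^esub> v = a \<odot>\<^bsub>E\<^esub> v \<oplus>\<^bsub>E\<^esub> b \<odot>\<^bsub>E\<^esub> v"
    if "a \<in> fractions C" "b \<in> fractions C" "v \<in> carrier E" for a b v
    using E.smult_l_distr[of a b v] that by simp
  have one: "1 \<odot>\<^bsub>E\<^esub> v = v" if "v \<in> carrier E" for v
    using E.smult_one[OF that] by simp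
  have closed: "a \<odot>\<^bsub>E\<^esub> v \<in> carrier E" if "a \<in> fractions C" "v \<in> carrier E" for a v
    using E.smult_closed[of a v] that by simp
  have mem: "Fract p 1 \<in> fractions C" if "p \<in> C" for p
    using that by (intro fractionsI one_unit)
  have const: "[:c:] \<in> C" for c
    using supported_monom[of c 0 S] zero_S by (simp add: monom_0)
  have inv: "Fract 1 w \<in> fractions C" if "w \<in> units_at_origin" for w
    using that by (intro fractionsI R.one_mem)
  note mult = supported_ideal_mult[OF T]
  have TS: "T \<subseteq> S"
    using T by (simp add: act.semigroup_ideal_def)
  fix z :: "nat \<Rightarrow> 'u"
  assume z: "\<And>\<tau>. \<tau> \<in> T \<Longrightarrow> z \<tau> \<in> carrier E"
    and z_tpow: "\<And>\<tau> s. \<tau> \<in> T \<Longrightarrow> s \<in> S \<Longrightarrow> tpow s \<odot>\<^bsub>E\<^esub> z \<tau> = z (\<tau> + s)"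
  define summand where "summand p \<tau> = Fract [:Polynomial.coeff p \<tau>:] 1 \<odot>\<^bsub>E\<^esub> z \<tau>" for p :: "'k poly" and \<tau>
  define h where "h p = finsum E (summand p) {\<tau>. Polynomial.coeff p \<tau> \<noteq> 0}" for p
  have summand_closed: "summand p \<tau> \<in> carrier E" if "\<tau> \<in> T" for p \<tau>
    using z[OF that] by (simp add: summand_def closed mem const)
  have h_wide: "h p = finsum E (summand p) F"
    if "finite F" "F \<subseteq> T" "{\<tau>. Polynomial.coeff p \<tau> \<noteq> 0} \<subseteq> F" for p F
    unfolding h_def
  proof (rule E.M.add.finprod_mono_neutral_cong_left[OF that(1) that(3)])
    fix \<tau>
    assume \<tau>: "\<tau> \<in> F - {\<tau>. Polynomial.coeff p \<tau> \<noteq> 0}"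
    then have "z \<tau> \<in> carrier E"
      using z that(2) by auto
    from E.smult_l_null[OF this] \<tau> show "summand p \<tau> = \<zero>\<^bsub>E\<^esub>"
      by (simp add: summand_def Zero_fract_def)
  qed (use that summand_closed in auto)
  have fin: "finite {\<tau>. Polynomial.coeff p \<tau> \<noteq> 0}" for p :: "'k poly"
    by (rule finite_subset[of _ "{..degree p}"]) (auto intro: le_degree)
  have supp: "{\<tau>. Polynomial.coeff p \<tau> \<noteq> 0} \<subseteq> T" if "p \<in> supported T" for p :: "'k poly"
    using that by (auto simp: supported_def)
  have h_closed: "h p \<in> carrier E" if "p \<in> supported T" for p
    unfolding h_def using summand_closed supp[OF that] by (intro E.M.finsum_closed) auto
  have h_add: "h (p + q) = h p \<oplus>\<^bsub>E\<^esub> h q" if p: "p \<in> supported T" and q: "q \<in> supported T" for p q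
  proof -
    let ?F = "{\<tau>. Polynomial.coeff p \<tau> \<noteq> 0} \<union> {\<tau>. Polynomial.coeff q \<tau> \<noteq> 0}"
    have F: "finite ?F" "?F \<subseteq> T"
      using fin supp[OF p] supp[OF q] by simp_all
    have "h (p + q) = finsum E (summand (p + q)) ?F"
      using F by (intro h_wide) auto
    also have "\<dots> = finsum E (\<lambda>\<tau>. summand p \<tau> \<oplus>\<^bsub>E\<^esub> summand q \<tau>) ?F"
    proof (rule E.M.finsum_cong')
      fix \<tau>
      assume "\<tau> \<in> ?F"
      then have "z \<tau> \<in> carrier E"
        using F z by blast
      from distr[OF mem[OF const] mem[OF const] this]
      show "summand (p + q) \<tau> = summand p \<tau> \<oplus>\<^bsub>E\<^esub> summand q \<tau>"
        by (simp add: summand_def)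
    qed (use summand_closed F in auto)
    also have "\<dots> = finsum E (summand p) ?F \<oplus>\<^bsub>E\<^esub> finsum E (summand q) ?F"
      using summand_closed F by (intro E.M.finsum_addf) auto
    also have "\<dots> = h p \<oplus>\<^bsub>E\<^esub> h q"
      using F by (simp add: h_wide[of ?F p] h_wide[of ?F q])
    finally show ?thesis .
  qed
  have h_monom: "h (Polynomial.monom c \<tau>) = Fract [:c:] 1 \<odot>\<^bsub>E\<^esub> z \<tau>" if "\<tau> \<in> T" for c \<tau>
  proof -
    have "h (Polynomial.monom c \<tau>) = finsum E (summand (Polynomial.monom c \<tau>)) {\<tau>}"
      using that by (intro h_wide) auto
    also have "\<dots> = summand (Polynomial.monom c \<tau>) \<tau>"
      using summand_closed[OF that] by (simp add: E.M.finsum_insert)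
    finally show ?thesis
      by (simp add: summand_def)
  qed
  have h_zero: "h 0 = \<zero>\<^bsub>E\<^esub>"
    by (simp add: h_def)
  have h_mult: "h (r * p) = Fract r 1 \<odot>\<^bsub>E\<^esub> h p" if r: "r \<in> C" and p: "p \<in> supported T" for r p
    using r
  proof (induction r rule: supported_induct)
    case zero
    show ?case
      using E.smult_l_null[OF h_closed[OF p]] by (simp add: h_zero Zero_fract_def)
  next
    case (monom c s)
    then have ms: "Polynomial.monom c s \<in> C"
      by simp
    show ?case
      using p
    proof (induction p rule: supported_induct)
      case zero
      show ?case
        using E.smult_r_null[of "Fract (Polynomial.monom c s) 1"] mem[OF ms] by (simp add: h_zero)
    next
      case (monom c' \<tau>)
      have \<tau>s: "s + \<tau> \<in> T"
        using monom \<open>s \<in> S\<close> T by (auto simp: act.semigroup_ideal_def add.commute)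
      have "Fract (Polynomial.monom c s) 1 \<odot>\<^bsub>E\<^esub> h (Polynomial.monom c' \<tau>)
          = Fract (Polynomial.monom (c * c') s) 1 \<odot>\<^bsub>E\<^esub> z \<tau>"
        using monom z mem[OF ms] by (simp add: h_monom assoc mem const mult.commute smult_monom)
      also have "\<dots> = Fract [:c * c':] 1 \<odot>\<^bsub>E\<^esub> (tpow s \<odot>\<^bsub>E\<^esub> z \<tau>)"
        using monom z \<open>s \<in> S\<close> act.tpow_closed[of s]
        by (subst assoc) (simp_all add: mem const tpow_def smult_monom)
      also have "\<dots> = Fract [:c * c':] 1 \<odot>\<^bsub>E\<^esub> z (s + \<tau>)"
        using z_tpow[of \<tau> s] monom \<open>s \<in> S\<close> by (simp add: add.commute)
      also have "\<dots> = h (Polynomial.monom c s * Polynomial.monom c' \<tau>)"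
        by (simp add: mult_monom h_monom \<tau>s)
      finally show ?case ..
    next
      case (add p q)
      then show ?case
        using mem[OF ms] by (simp add: distrib_left h_add h_closed mult[OF ms] E.smult_r_distr)
    qed
  next
    case (add r r')
    then show ?case
      using distr[OF mem mem h_closed[OF p], of r r']
      by (simp add: distrib_right h_add mult[OF _ p])
  qed
  define J where "J = fractions (supported T)"
  \<comment> \<open>The value of \<open>g\<close> is defined through an arbitrary representation as a fraction.\<close>
  define g where "g q = (SOME e. \<exists>p w. p \<in> supported T \<and> w \<in> units_at_origin \<and> q = Fract p w
      \<and> e = Fract 1 w \<odot>\<^bsub>E\<^esub> h p)" for q
  have g_eq: "g (Fract p w) = Fract 1 w \<odot>\<^bsub>E\<^esub> h p" if p: "p \<in> supported T" and w: "w \<in> units_at_origin" for p w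
  proof -
    have "\<exists>p' w'. p' \<in> supported T \<and> w' \<in> units_at_origin \<and> Fract p w = Fract p' w'
        \<and> g (Fract p w) = Fract 1 w' \<odot>\<^bsub>E\<^esub> h p'"
      unfolding g_def by (rule someI_ex) (use that in blast)
    then obtain p' w' where p': "p' \<in> supported T" and w': "w' \<in> units_at_origin"
      and eq: "Fract p w = Fract p' w'" and g: "g (Fract p w) = Fract 1 w' \<odot>\<^bsub>E\<^esub> h p'"
      by blast
    have cross: "w * p' = w' * p"
      using eq unit_nonzero[OF w] unit_nonzero[OF w'] by (simp add: eq_fract mult.commute)
    have split: "Fract 1 w' = Fract 1 w * Fract 1 w' * Fract w 1" "Fract 1 w = Fract 1 w * Fract 1 w' * Fract w' 1"
      using unit_nonzero[OF w] unit_nonzero[OF w'] by (simp_all add: eq_fract)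
    have ww: "Fract 1 w * Fract 1 w' \<in> fractions C"
      by (intro L.mult_mem inv w w')
    have "Fract 1 w' \<odot>\<^bsub>E\<^esub> h p' = (Fract 1 w * Fract 1 w') \<odot>\<^bsub>E\<^esub> h (w * p')"
      by (subst split(1), subst assoc[symmetric])
        (use ww w p' in \<open>auto simp: mem unit_C h_closed h_mult\<close>)
    also have "\<dots> = (Fract 1 w * Fract 1 w') \<odot>\<^bsub>E\<^esub> h (w' * p)"
      by (simp only: cross)
    also have "\<dots> = Fract 1 w \<odot>\<^bsub>E\<^esub> h p"
      by (subst (2) split(2), subst assoc[symmetric])
        (use ww w' p in \<open>auto simp: mem unit_C h_closed h_mult\<close>)
    finally show ?thesis
      using g by simp
  qed
  have g_closed: "g q \<in> carrier E" if "q \<in> J" for q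
    using that unfolding J_def by (elim fractionsE) (simp add: g_eq closed inv h_closed)
  have g_add: "g (q + q') = g q \<oplus>\<^bsub>E\<^esub> g q'" if "q \<in> J" "q' \<in> J" for q q'
  proof -
    obtain p w where q: "p \<in> supported T" "w \<in> units_at_origin" "q = Fract p w"
      using \<open>q \<in> J\<close> unfolding J_def by (rule fractionsE)
    obtain p' w' where q': "p' \<in> supported T" "w' \<in> units_at_origin" "q' = Fract p' w'"
      using \<open>q' \<in> J\<close> unfolding J_def by (rule fractionsE)
    have wC: "w \<in> C" "w' \<in> C" and w0: "w \<noteq> 0" "w' \<noteq> 0"
      using q q' by (simp_all add: unit_C unit_nonzero)
    have sum: "q + q' = Fract (w' * p + w * p') (w * w')"
      using w0 by (simp add: q(3) q'(3) mult.commute)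
    have "g (q + q') = Fract 1 (w * w') \<odot>\<^bsub>E\<^esub> (Fract w' 1 \<odot>\<^bsub>E\<^esub> h p \<oplus>\<^bsub>E\<^esub> Fract w 1 \<odot>\<^bsub>E\<^esub> h p')"
      unfolding sum using q q' wC by (simp add: g_eq supported_add mult mult_unit h_add h_mult)
    also have "\<dots> = (Fract 1 (w * w') * Fract w' 1) \<odot>\<^bsub>E\<^esub> h p
        \<oplus>\<^bsub>E\<^esub> (Fract 1 (w * w') * Fract w 1) \<odot>\<^bsub>E\<^esub> h p'"
      using inv[OF mult_unit[OF q(2) q'(2)]] mem[OF wC(1)] mem[OF wC(2)] h_closed[OF q(1)] h_closed[OF q'(1)]
      by (simp add: E.smult_r_distr assoc closed del: mult_fract)
    also have "Fract 1 (w * w') * Fract w' 1 = Fract 1 w"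
      using w0 by (simp add: eq_fract)
    also have "Fract 1 (w * w') * Fract w 1 = Fract 1 w'"
      using w0 by (simp add: eq_fract)
    finally show ?thesis
      using q q' by (simp add: g_eq)
  qed
  have g_smult: "g (b * q) = b \<odot>\<^bsub>E\<^esub> g q" if "b \<in> fractions C" "q \<in> J" for b q
  proof -
    obtain r v where b: "r \<in> C" "v \<in> units_at_origin" "b = Fract r v"
      using \<open>b \<in> fractions C\<close> by (rule fractionsE)
    obtain p w where q: "p \<in> supported T" "w \<in> units_at_origin" "q = Fract p w"
      using \<open>q \<in> J\<close> unfolding J_def by (rule fractionsE)
    have "g (b * q) = Fract 1 (v * w) \<odot>\<^bsub>E\<^esub> (Fract r 1 \<odot>\<^bsub>E\<^esub> h p)"
      using b q by (simp add: g_eq mult mult_unit h_mult)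
    also have "\<dots> = b \<odot>\<^bsub>E\<^esub> (Fract 1 w \<odot>\<^bsub>E\<^esub> h p)"
      using b q that(1) by (simp add: assoc mem inv mult_unit h_closed)
    finally show ?thesis
      using q by (simp add: g_eq)
  qed
  have "g \<in> module_hom L.R (ideal_module L.R J) E"
    using g_closed g_add g_smult by (simp add: module_hom_def ideal_module_def ring_module_def Pi_iff)
  moreover have "(\<lambda>q. q) \<in> module_hom L.R (ideal_module L.R J) (ring_module L.R)"
    using ideal_fractions[OF T] by (auto simp: L.module_hom_ideal_iff L.ideal_iff J_def)
  moreover have "Module.module L.R (ideal_module L.R J)"
    unfolding J_def by (intro L.module_ideal_module ideal_fractions T)
  ultimately have "\<exists>f\<in>module_hom L.R (ring_module L.R) E. \<forall>q\<in>carrier (ideal_module L.R J). f q = g q"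
    using inj L.module_ring_module unfolding injective_module_def by auto
  then obtain f where f: "f \<in> module_hom L.R (ring_module L.R) E" "\<And>q. q \<in> J \<Longrightarrow> f q = g q"
    by (auto simp: ideal_module_def)
  have f_lin: "f (b * q) = b \<odot>\<^bsub>E\<^esub> f q" if "b \<in> fractions C" "q \<in> fractions C" for b q
    using f(1) that by (auto simp: module_hom_def ring_module_def)
  have "f 1 \<in> carrier E"
    using f(1) L.one_mem by (auto simp: module_hom_def ring_module_def)
  moreover have "tpow \<tau> \<odot>\<^bsub>E\<^esub> f 1 = z \<tau>" if \<tau>: "\<tau> \<in> T" for \<tau>
  proof -
    have "tpow \<tau> \<odot>\<^bsub>E\<^esub> f 1 = f (tpow \<tau>)"
      using f_lin[of "tpow \<tau>" 1] act.tpow_closed[of \<tau>] \<tau> TS L.one_mem by auto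
    also have "\<dots> = g (tpow \<tau>)"
      using \<tau> by (intro f(2)) (simp add: J_def tpow_def fractionsI one_unit)
    also have "\<dots> = z \<tau>"
      using z[OF \<tau>] \<tau> one by (simp add: tpow_def g_eq one_unit h_monom flip: One_fract_def one_pCons)
    finally show ?thesis .
  qed
  ultimately show "\<exists>f\<in>carrier E. \<forall>\<tau>\<in>T. tpow \<tau> \<odot>\<^bsub>E\<^esub> f = z \<tau>"
    by blast
qed

end


section \<open>Symmetry of Gorenstein semigroup rings\<close>

context numerical_semigroup_ring
begin

text \<open>
  The set \<open>S - (a + S)\<close> is the Apery set of \<open>S\<close> with respect to \<open>a\<close>.
\<close>

lemma finite_apery:
  assumes "a \<in> S"
  shows "finite (S - (+) a ` S)"
proof (rule finite_subset)
  show "S - (+) a ` S \<subseteq> {..<a} \<union> (+) a ` (- S)"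
  proof
    fix e
    assume e: "e \<in> S - (+) a ` S"
    show "e \<in> {..<a} \<union> (+) a ` (- S)"
    proof (cases "e < a")
      case False
      then have "e = a + (e - a)"
        by simp
      with e show ?thesis
        by blast
    qed simp
  qed
  show "finite ({..<a} \<union> (+) a ` (- S))"
    using cofinite_S by simp
qed

text \<open>
  The socle degrees are the maximal elements of the finite Apery set with respect to the order
  induced by adding elements of \<open>S\<close>.
\<close>

lemma socle_degree_above:
  assumes a: "a \<in> S" and e: "e \<in> S - (+) a ` S"
  shows "\<exists>s\<in>S. act.socle_degree a (e + s)"
proof -
  define D where "D = {s \<in> S. e + s \<notin> (+) a ` S}"
  have "(+) e ` D \<subseteq> S - (+) a ` S"
    using e add_S by (auto simp: D_def)
  then have "finite D"
    using finite_apery[OF a] by (metis finite_imageD finite_subset inj_on_add)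
  moreover have "0 \<in> D"
    using zero_S e by (simp add: D_def)
  ultimately have s: "Max D \<in> D" and max: "\<And>s. s \<in> D \<Longrightarrow> s \<le> Max D"
    by (auto intro: Max_in)
  have "e + Max D + s' \<in> (+) a ` S" if "s' \<in> S - {0}" for s'
    using max[of "Max D + s'"] s that add_S by (auto simp: D_def add.assoc)
  with s e add_S have "act.socle_degree a (e + Max D)"
    by (simp add: act.socle_degree_def D_def)
  with s show ?thesis
    by (auto simp: D_def)
qed

text \<open>
  If \<open>B / t ^ a\<close> is self-injective, then \<open>t ^ g \<mapsto> t ^ g'\<close> extends to multiplication by some \<open>b \<in> B\<close>, so
  \<open>t ^ g' \<in> t ^ g B + t ^ a B\<close>; comparing coefficients at \<open>g'\<close> gives \<open>g = g'\<close>. To obtain \<open>b\<close> from the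
  resolution, \<open>B / t ^ a\<close> is compared with the submodule of \<open>E 0 / B\<close> killed by \<open>t ^ a\<close>: a fraction with
  denominator \<open>t ^ a\<close>, represented by an element of \<open>E 0\<close>, has a class in \<open>E 0 / B\<close>, and \<open>E 0 / B\<close> is the
  image of \<open>d 0\<close>.
\<close>

lemma socle_degree_unique:
  assumes inj: "finite_injective_dimension TYPE('u) L.R (ring_module L.R)"
    and a: "a \<in> S - {0}" and g: "act.socle_degree a g" and g': "act.socle_degree a g'"
  shows "g = g'"
proof -
  obtain s and E :: "nat \<Rightarrow> ('k poly fract, 'u) module" and \<epsilon> d where
    E_inj': "\<forall>i. injective_module L.R (E i)"
    and E_zero': "\<forall>i>s. carrier (E i) = {\<zero>\<^bsub>E i\<^esub>}"
    and \<epsilon>: "\<epsilon> \<in> module_hom L.R (ring_module L.R) (E 0)" "inj_on \<epsilon> (carrier (ring_module L.R))"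
    and d': "\<forall>i. d i \<in> module_hom L.R (E i) (E (Suc i))"
    and exact0: "\<epsilon> ` carrier (ring_module L.R) = {v \<in> carrier (E 0). d 0 v = \<zero>\<^bsub>E (Suc 0)\<^esub>}"
    and exact': "\<forall>i. d i ` carrier (E i) =
      {v \<in> carrier (E (Suc i)). d (Suc i) v = \<zero>\<^bsub>E (Suc (Suc i))\<^esub>}"
    using inj unfolding finite_injective_dimension_def by (elim conjE exE) (rule that; assumption)
  note E_inj = E_inj'[rule_format] and E_zero = E_zero'[rule_format]
    and d = d'[rule_format] and exact = exact'[rule_format]
  have E: "Module.module L.R (E i)" for i
    using E_inj[of i] by (simp add: injective_module_def)
  interpret E0: module L.R "E 0" by (rule E)
  interpret E1: module L.R "E (Suc 0)" by (rule E)
  have carr: "carrier (ring_module L.R) = fractions C"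
    by (simp add: ring_module_def)
  have aS: "a \<in> S" and gS: "g \<in> S" and gS': "g' \<in> S"
    using a g g' by (auto simp: act.socle_degree_def)
  have tpow: "tpow s \<in> fractions C" if "s \<in> S" for s
    using act.tpow_closed[OF that] by simp
  have tpow_add: "tpow s * tpow s' = tpow (s + s')" if "s \<in> S" "s' \<in> S" for s s'
    using act.tpow_add[OF that] by simp
  have \<epsilon>_closed: "\<epsilon> b \<in> carrier (E 0)" if "b \<in> fractions C" for b
    using \<epsilon>(1) that carr by (auto simp: module_hom_def)
  have \<epsilon>_add: "\<epsilon> (b + c) = \<epsilon> b \<oplus>\<^bsub>E 0\<^esub> \<epsilon> c" if "b \<in> fractions C" "c \<in> fractions C" for b c
    using \<epsilon>(1) that by (auto simp: module_hom_def ring_module_def)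
  have \<epsilon>_tpow: "tpow s \<odot>\<^bsub>E 0\<^esub> \<epsilon> b = \<epsilon> (tpow s * b)" if "s \<in> S" "b \<in> fractions C" for s b
    using \<epsilon>(1) that tpow by (auto simp: module_hom_def ring_module_def)
  have d_closed: "d 0 v \<in> carrier (E (Suc 0))" if "v \<in> carrier (E 0)" for v
    using d[of 0] that by (auto simp: module_hom_def)
  have d_add: "d 0 (v \<oplus>\<^bsub>E 0\<^esub> w) = d 0 v \<oplus>\<^bsub>E (Suc 0)\<^esub> d 0 w" if "v \<in> carrier (E 0)" "w \<in> carrier (E 0)" for v w
    using d[of 0] that by (auto simp: module_hom_def)
  have d_tpow: "d 0 (tpow s \<odot>\<^bsub>E 0\<^esub> v) = tpow s \<odot>\<^bsub>E (Suc 0)\<^esub> d 0 v" if "v \<in> carrier (E 0)" "s \<in> S" for v s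
    using d[of 0] that tpow by (auto simp: module_hom_def)
  have tpow_E0: "tpow s \<odot>\<^bsub>E 0\<^esub> v \<in> carrier (E 0)" if "s \<in> S" "v \<in> carrier (E 0)" for s v
    using E0.smult_closed[of "tpow s" v] that tpow by simp
  have \<epsilon>_ker: "d 0 (\<epsilon> b) = \<zero>\<^bsub>E (Suc 0)\<^esub>" if "b \<in> fractions C" for b
    using exact0 that carr by blast
  have ker_\<epsilon>: "\<exists>b\<in>fractions C. v = \<epsilon> b" if "v \<in> carrier (E 0)" "d 0 v = \<zero>\<^bsub>E (Suc 0)\<^esub>" for v
  proof -
    have "v \<in> \<epsilon> ` carrier (ring_module L.R)"
      unfolding exact0 using that by simp
    then show ?thesis
      unfolding carr by blast
  qed
  have shift: "g' + \<tau> - a \<in> S" "a \<le> g' + \<tau>" if "\<tau> \<in> S - {0}" for \<tau>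
  proof -
    have "g' + \<tau> \<in> (+) a ` S"
      using g' that unfolding act.socle_degree_def by blast
    then show "g' + \<tau> - a \<in> S" "a \<le> g' + \<tau>"
      by auto
  qed
  \<comment> \<open>The element \<open>e'\<close> plays the role of the fraction \<open>t ^ g' / t ^ a\<close>, whose products with positive powers
    of \<open>t\<close> lie in \<open>B\<close>.\<close>
  have "\<exists>e\<in>carrier (E 0). \<forall>\<tau>\<in>S - {0}. tpow \<tau> \<odot>\<^bsub>E 0\<^esub> e = \<epsilon> (tpow (g' + \<tau> - a))"
  proof (rule act.extendsD[OF injective_extends[OF E_inj act.semigroup_ideal_maximal]])
    fix \<tau> s
    assume \<tau>: "\<tau> \<in> S - {0}" and s: "s \<in> S"
    have "tpow s \<odot>\<^bsub>E 0\<^esub> \<epsilon> (tpow (g' + \<tau> - a)) = \<epsilon> (tpow (s + (g' + \<tau> - a)))"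
      using s shift[OF \<tau>] by (simp add: \<epsilon>_tpow tpow tpow_add)
    also have "s + (g' + \<tau> - a) = g' + (\<tau> + s) - a"
      using shift[OF \<tau>] by simp
    finally show "tpow s \<odot>\<^bsub>E 0\<^esub> \<epsilon> (tpow (g' + \<tau> - a)) = \<epsilon> (tpow (g' + (\<tau> + s) - a))" .
  qed (use shift \<epsilon>_closed tpow in blast)
  then obtain e' where e': "e' \<in> carrier (E 0)"
    "\<And>\<tau>. \<tau> \<in> S - {0} \<Longrightarrow> tpow \<tau> \<odot>\<^bsub>E 0\<^esub> e' = \<epsilon> (tpow (g' + \<tau> - a))"
    by blast
  \<comment> \<open>Its class in \<open>E 0 / B\<close> is a socle element, so it is \<open>t ^ g\<close> times a class killed by \<open>t ^ a\<close>.\<close>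
  have "\<exists>f\<in>d 0 ` carrier (E 0). tpow a \<odot>\<^bsub>E (Suc 0)\<^esub> f = \<zero>\<^bsub>E (Suc 0)\<^esub> \<and> tpow g \<odot>\<^bsub>E (Suc 0)\<^esub> f = d 0 e'"
  proof (rule act.extends_socle[OF E _ _ aS g])
    show "act.extends (E (Suc 0)) (d 0 ` carrier (E 0)) (insert g ((+) a ` S))"
    proof (rule act.extends_cocycles[where E = E and d = d and i = 0])
      show "Module.module L.R (E i)" "d i \<in> module_hom L.R (E i) (E (Suc i))" for i
        by (rule E, rule d)
      show "d i ` carrier (E i) =
        {v \<in> carrier (E (Suc i)). d (Suc i) v = \<zero>\<^bsub>E (Suc (Suc i))\<^esub>}" for i
        by (rule exact)
      show "carrier (E i) = {\<zero>\<^bsub>E i\<^esub>}" if "s < i" for i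
        using that by (rule E_zero)
      show "act.extends (E i) (carrier (E i)) T" if "act.semigroup_ideal T" for i T
        using E_inj that by (rule injective_extends)
      show "act.semigroup_ideal (insert g ((+) a ` S))"
        using aS g by (rule act.semigroup_ideal_socle)
      show "finite (S - insert g ((+) a ` S))"
        using aS by (intro act.finite_minus_semigroup_ideal finite_apery)
    qed (use a g finite_apery[OF aS] in auto)
    show "\<zero>\<^bsub>E (Suc 0)\<^esub> \<in> d 0 ` carrier (E 0)"
      using \<epsilon>_ker[OF L.zero_mem] \<epsilon>_closed[OF L.zero_mem] by (metis imageI)
  next
    fix s
    assume "s \<in> S - {0}"
    then show "tpow s \<odot>\<^bsub>E (Suc 0)\<^esub> d 0 e' = \<zero>\<^bsub>E (Suc 0)\<^esub>"
      using d_tpow[OF e'(1), of s] e'(2) shift \<epsilon>_ker tpow by auto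
  qed (use d_closed e'(1) in auto)
  then obtain e where e: "e \<in> carrier (E 0)"
    "tpow a \<odot>\<^bsub>E (Suc 0)\<^esub> d 0 e = \<zero>\<^bsub>E (Suc 0)\<^esub>" "tpow g \<odot>\<^bsub>E (Suc 0)\<^esub> d 0 e = d 0 e'"
    by blast
  \<comment> \<open>Multiplying the relation \<open>t ^ g e - e' \<in> B\<close> by \<open>t ^ a\<close> leaves an equation in \<open>B\<close>.\<close>
  obtain b where b: "b \<in> fractions C" "tpow a \<odot>\<^bsub>E 0\<^esub> e = \<epsilon> b"
    using ker_\<epsilon>[of "tpow a \<odot>\<^bsub>E 0\<^esub> e"] e d_tpow aS tpow_E0 by auto
  let ?c = "tpow g \<odot>\<^bsub>E 0\<^esub> e \<ominus>\<^bsub>E 0\<^esub> e'"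
  have ge: "tpow g \<odot>\<^bsub>E 0\<^esub> e \<in> carrier (E 0)"
    using gS e(1) by (rule tpow_E0)
  have c_closed: "?c \<in> carrier (E 0)"
    using ge e'(1) by simp
  have sum: "e' \<oplus>\<^bsub>E 0\<^esub> ?c = tpow g \<odot>\<^bsub>E 0\<^esub> e"
    using ge e'(1) by (simp add: a_minus_def E0.M.a_comm[of e'] E0.M.a_assoc E0.M.l_neg)
  then have "d 0 e' \<oplus>\<^bsub>E (Suc 0)\<^esub> d 0 ?c = d 0 e'"
    using d_add[OF e'(1) c_closed] d_tpow[OF e(1) gS] e(3) by simp
  then have "d 0 ?c = \<zero>\<^bsub>E (Suc 0)\<^esub>"
    using d_closed[OF e'(1)] d_closed[OF c_closed] by (simp only: E1.M.add.l_cancel_one)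
  then obtain c where c: "c \<in> fractions C" "?c = \<epsilon> c"
    using ker_\<epsilon>[OF c_closed] by blast
  have "\<epsilon> (tpow g' + tpow a * c) = \<epsilon> (tpow g') \<oplus>\<^bsub>E 0\<^esub> \<epsilon> (tpow a * c)"
    using tpow gS' aS c L.mult_mem by (intro \<epsilon>_add) auto
  also have "\<epsilon> (tpow g') = tpow a \<odot>\<^bsub>E 0\<^esub> e'"
    using e'(2)[OF a] by simp
  also have "\<epsilon> (tpow a * c) = tpow a \<odot>\<^bsub>E 0\<^esub> ?c"
    using \<epsilon>_tpow[OF aS c(1)] c(2) by simp
  also have "tpow a \<odot>\<^bsub>E 0\<^esub> e' \<oplus>\<^bsub>E 0\<^esub> tpow a \<odot>\<^bsub>E 0\<^esub> ?c = tpow a \<odot>\<^bsub>E 0\<^esub> (tpow g \<odot>\<^bsub>E 0\<^esub> e)"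
    using E0.smult_r_distr[of "tpow a" e' ?c] tpow[OF aS] e'(1) c_closed sum by simp
  also have "\<dots> = tpow g \<odot>\<^bsub>E 0\<^esub> (tpow a \<odot>\<^bsub>E 0\<^esub> e)"
    using act.tpow_action[OF E] e(1) aS gS by (simp add: add.commute)
  also have "\<dots> = \<epsilon> (tpow g * b)"
    using b gS by (simp add: \<epsilon>_tpow)
  finally have eq: "tpow g' + tpow a * c = tpow g * b"
    using \<epsilon>(2) tpow gS gS' aS b(1) c(1) L.add_mem L.mult_mem by (simp add: carr inj_on_def)
  obtain p w where p: "p \<in> C" "w \<in> units_at_origin" "b = Fract p w"
    using b(1) by (rule fractionsE)
  obtain p' w' where p': "p' \<in> C" "w' \<in> units_at_origin" "c = Fract p' w'"
    using c(1) by (rule fractionsE)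
  have "Polynomial.monom 1 g' * (w * w') + Polynomial.monom 1 a * (p' * w)
      = Polynomial.monom 1 g * (p * w')"
    using eq unit_nonzero[OF p(2)] unit_nonzero[OF p'(2)]
    by (simp add: p(3) p'(3) tpow_def eq_fract algebra_simps)
  then have "Polynomial.coeff (Polynomial.monom 1 g' * (w * w') + Polynomial.monom 1 a * (p' * w)) g'
      = Polynomial.coeff (Polynomial.monom 1 g * (p * w')) g'"
    by (rule arg_cong)
  moreover have "Polynomial.coeff (Polynomial.monom 1 a * (p' * w)) g' = 0"
  proof (cases "a \<le> g' \<and> g' - a \<in> S")
    case True
    then have "g' \<in> (+) a ` S"
      by (auto intro: image_eqI[of _ _ "g' - a"])
    with g' show ?thesis
      by (simp add: act.socle_degree_def)
  next
    case False
    then show ?thesis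
      using R.mult_mem[OF p'(1) unit_C[OF p(2)]]
      by (auto simp: coeff_monom_mult supported_def)
  qed
  moreover have "Polynomial.coeff (w * w') 0 \<noteq> 0"
    using mult_unit[OF p(2) p'(2)] by (simp add: units_at_origin_def)
  ultimately have "Polynomial.coeff (Polynomial.monom 1 g * (p * w')) g' \<noteq> 0"
    by (simp add: coeff_monom_mult)
  then have le: "g \<le> g'" and diff: "g' - g \<in> S"
    using R.mult_mem[OF p(1) unit_C[OF p'(2)]]
    by (auto simp: coeff_monom_mult supported_def split: if_splits)
  show "g = g'"
  proof (rule ccontr)
    assume "g \<noteq> g'"
    with le diff have "g' - g \<in> S - {0}"
      by simp
    with g have "g + (g' - g) \<in> (+) a ` S"
      unfolding act.socle_degree_def by blast
    with le g' show False
      by (simp add: act.socle_degree_def)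
  qed
qed

definition origin_ideal :: "'k poly set"
  where "origin_ideal = {p \<in> C. Polynomial.coeff p 0 = 0}"

lemma maximalideal_origin: "maximalideal origin_ideal R.R"
proof (rule maximalidealI)
  show "ideal origin_ideal R.R"
    unfolding R.ideal_iff
    by (auto simp: origin_ideal_def R.add_mem R.mult_mem coeff_mult_0)
  show "carrier R.R \<noteq> origin_ideal"
  proof
    assume "carrier R.R = origin_ideal"
    then have "1 \<in> origin_ideal"
      using R.one_mem by simp
    then show False
      by (simp add: origin_ideal_def)
  qed
next
  fix J
  assume J: "ideal J R.R" "origin_ideal \<subseteq> J" "J \<subseteq> carrier R.R"
  note J' = J(1)[unfolded R.ideal_iff]
  have "J = carrier R.R" if "J \<noteq> origin_ideal"
  proof -
    from that J(2) obtain p where p: "p \<in> J" "p \<notin> origin_ideal"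
      by blast
    define c where "c = Polynomial.coeff p 0"
    have pC: "p \<in> C"
      using p J' by blast
    with p have c: "c \<noteq> 0"
      by (simp add: origin_ideal_def c_def)
    have const: "[:b:] \<in> C" for b
      using supported_monom[of b 0 S] zero_S by (simp add: monom_0)
    have "[:c:] - p \<in> origin_ideal"
      using R.diff_mem[OF const pC] by (simp add: origin_ideal_def c_def)
    then have "[:c:] - p + p \<in> J"
      using J' J(2) p by blast
    then have "[:c:] \<in> J"
      by simp
    then have "[:1 / c:] * [:c:] \<in> J"
      using J' const by blast
    then have "1 \<in> J"
      using c by (simp flip: one_pCons)
    then have "r \<in> J" if "r \<in> C" for r
      using J' that by (metis mult.right_neutral)
    with J(3) show ?thesis
      by auto
  qed
  then show "J = origin_ideal \<or> J = carrier R.R"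
    by blast
qed

lemma localization_origin: "localization R.R origin_ideal = L.R"
proof -
  have "{Fract p w | p w. p \<in> carrier R.R \<and> w \<in> carrier R.R - origin_ideal} = fractions C"
    by (auto simp: fractions_def units_at_origin_def origin_ideal_def)
  then show ?thesis
    by (simp add: localization_def)
qed

lemma gorenstein_socle_degree_unique:
  assumes "gorenstein_ring TYPE('u) R.R" "a \<in> S - {0}" "act.socle_degree a g" "act.socle_degree a g'"
  shows "g = g'"
proof (rule socle_degree_unique[OF _ assms(2-4)])
  show "finite_injective_dimension TYPE('u) L.R (ring_module L.R)"
    using assms(1) maximalideal_origin unfolding gorenstein_ring_def localization_origin[symmetric]
    by blast
qed

text \<open>
  If \<open>e \<notin> a + S\<close>, then \<open>e + s\<close> is the socle degree for some \<open>s \<in> S\<close>. As \<open>e + s \<notin> a + S\<close>, the colon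
  condition excludes \<open>s + b \<in> a + S\<close>, so \<open>s + b\<close> can also be completed to the socle degree:
  \<open>e + s = s + b + s'\<close>. Cancelling \<open>s\<close> gives \<open>e \<in> b + S\<close>.
\<close>

lemma double_colon_degrees:
  assumes unique: "\<And>g g'. act.socle_degree a g \<Longrightarrow> act.socle_degree a g' \<Longrightarrow> g = g'"
    and S: "a \<in> S" "b \<in> S" "e \<in> S"
    and colon: "\<And>s. s \<in> S \<Longrightarrow> s + b \<in> (+) a ` S \<Longrightarrow> s + e \<in> (+) a ` S"
  shows "e \<in> (+) a ` S \<union> (+) b ` S"
proof (cases "e \<in> (+) a ` S")
  case False
  then obtain s where s: "s \<in> S" "act.socle_degree a (e + s)"
    using socle_degree_above[of a e] S by blast
  then have "s + b \<notin> (+) a ` S"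
    using colon[OF s(1)] by (auto simp: act.socle_degree_def add.commute)
  then obtain s' where s': "s' \<in> S" "act.socle_degree a (s + b + s')"
    using socle_degree_above[of a "s + b"] S s(1) add_S by blast
  have "e + s = s + b + s'"
    using unique[OF s(2) s'(2)] .
  with s'(1) show ?thesis
    by auto
qed simp

lemma reflexive_monomial_pair:
  assumes unique: "\<And>g g'. act.socle_degree a g \<Longrightarrow> act.socle_degree a g' \<Longrightarrow> g = g'"
    and S: "a \<in> S" "b \<in> S" and nz: "\<alpha> \<noteq> 0" "\<beta> \<noteq> (0 :: 'k)"
  shows "reflexive_module R.R (ideal_module R.R
    (genideal R.R {Polynomial.monom \<alpha> a, Polynomial.monom \<beta> b}))"
proof (rule R.reflexive_pairI)
  let ?x = "Polynomial.monom \<alpha> a" and ?y = "Polynomial.monom \<beta> b"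
  show C: "?x \<in> C" "?y \<in> C" and "?x \<noteq> 0"
    using S nz by simp_all
  fix z
  assume z: "z \<in> C" and colon: "\<And>r. r \<in> colon R.R ?x ?y \<Longrightarrow> \<exists>s\<in>C. r * z = ?x * s"
  let ?J = "genideal R.R {?x, ?y}"
  have J: "ideal ?J R.R" "?x \<in> ?J" "?y \<in> ?J"
    using R.ideal_pair[OF C] R.pair_mem[of ?x ?y] R.pair_mem[of ?y ?x] by auto
  note J' = J(1)[unfolded R.ideal_iff]
  have "e \<in> (+) a ` S \<union> (+) b ` S" if e: "Polynomial.coeff z e \<noteq> 0" for e
  proof (rule double_colon_degrees[OF unique S])
    show "e \<in> S"
      using z e by (simp add: supported_def)
    fix s
    assume s: "s \<in> S" "s + b \<in> (+) a ` S"
    then obtain s' where s': "s' \<in> S" "s + b = a + s'"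
      by blast
    have "Polynomial.monom 1 s \<in> colon R.R ?x ?y"
      unfolding R.colon_iff using s s' nz
      by (auto simp: mult_monom intro!: bexI[of _ "Polynomial.monom (\<beta> / \<alpha>) s'"])
    from colon[OF this] obtain q where q: "q \<in> C" "Polynomial.monom 1 s * z = ?x * q"
      by blast
    have "Polynomial.coeff (?x * q) (s + e) \<noteq> 0"
      unfolding q(2)[symmetric] using e by (simp add: coeff_monom_mult)
    then have "a \<le> s + e" "s + e - a \<in> S"
      using q(1) by (auto simp: coeff_monom_mult supported_def split: if_splits)
    then show "s + e \<in> (+) a ` S"
      by (auto intro: image_eqI[of _ _ "s + e - a"])
  qed
  then have "z \<in> supported ((+) a ` S \<union> (+) b ` S)"
    by (auto simp: supported_def)
  then show "z \<in> ?J"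
  proof (induction z rule: supported_induct)
    case (monom c \<tau>)
    then consider s where "s \<in> S" "\<tau> = a + s" | s where "s \<in> S" "\<tau> = b + s"
      by blast
    then show ?case
    proof cases
      case 1
      then have "Polynomial.monom (c / \<alpha>) s * ?x \<in> ?J"
        using J' J(2) by simp
      with 1 nz show ?thesis
        by (simp add: mult_monom add.commute)
    next
      case 2
      then have "Polynomial.monom (c / \<beta>) s * ?y \<in> ?J"
        using J' J(3) by simp
      with 2 nz show ?thesis
        by (simp add: mult_monom add.commute)
    qed
  qed (use J' in auto)
qed

text \<open>
  For \<open>a = 0\<close> there is no socle degree, so uniqueness is vacuous.
\<close>

lemma gorenstein_reflexive_monomial_pair:
  assumes "gorenstein_ring TYPE('u) R.R" "a \<in> S" "b \<in> S" "\<alpha> \<noteq> 0" "\<beta> \<noteq> (0 :: 'k)"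
  shows "reflexive_module R.R (ideal_module R.R
    (genideal R.R {Polynomial.monom \<alpha> a, Polynomial.monom \<beta> b}))"
proof (rule reflexive_monomial_pair[OF _ assms(2-)])
  fix g g'
  assume g: "act.socle_degree a g" "act.socle_degree a g'"
  then have "a \<noteq> 0"
    by (auto simp: act.socle_degree_def)
  with gorenstein_socle_degree_unique[OF assms(1)] assms(2) g show "g = g'"
    by blast
qed

end


section \<open>Syzygies of monomials\<close>

text \<open>
  The vector \<open>r e j - s e i\<close>; it is a syzygy if \<open>r x j = s x i\<close>.
\<close>

definition binomial_vector :: "nat \<Rightarrow> nat \<Rightarrow> 'a \<Rightarrow> 'a \<Rightarrow> nat \<Rightarrow> 'a::comm_ring_1"
  where "binomial_vector i j r s = (\<lambda>k. if k = j then r else if k = i then - s else 0)"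

context domain_subring
begin

lemma syzygy_iff:
  assumes x: "x ` {1..m} \<subseteq> C"
  shows "v \<in> carrier (first_syzygy R m x) \<longleftrightarrow>
    (\<forall>i\<in>{1..m}. v i \<in> C) \<and> (\<forall>i. i \<notin> {1..m} \<longrightarrow> v i = 0) \<and> (\<Sum>i\<in>{1..m}. v i * x i) = 0"
proof -
  have "(\<Oplus>\<^bsub>R\<^esub>i\<in>{1..m}. v i \<otimes>\<^bsub>R\<^esub> x i) = (\<Sum>i\<in>{1..m}. v i * x i)" if "\<forall>i\<in>{1..m}. v i \<in> C"
    using finsum_eq_sum[of "{1..m}" "\<lambda>i. v i * x i"] that x by (auto simp: mult_mem image_subset_iff)
  then show ?thesis
    by (auto simp: first_syzygy_def free_module_def)
qed

lemma syzygy_module_simps: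
  "u \<oplus>\<^bsub>first_syzygy R m x\<^esub> v = (\<lambda>i. u i + v i)" "r \<odot>\<^bsub>first_syzygy R m x\<^esub> v = (\<lambda>i. r * v i)"
  by (simp_all add: first_syzygy_def free_module_def)

lemma syzygy_hom_iff:
  "f \<in> module_hom R (first_syzygy R m x) (ring_module R) \<longleftrightarrow>
    (\<forall>v\<in>carrier (first_syzygy R m x). f v \<in> C) \<and>
    (\<forall>u\<in>carrier (first_syzygy R m x). \<forall>v\<in>carrier (first_syzygy R m x). f (\<lambda>i. u i + v i) = f u + f v) \<and>
    (\<forall>r\<in>C. \<forall>v\<in>carrier (first_syzygy R m x). f (\<lambda>i. r * v i) = r * f v)"
  unfolding module_hom_def syzygy_module_simps by (auto simp: ring_module_def Pi_iff)

lemma binomial_syzygy: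
  assumes x: "x ` {1..m} \<subseteq> C" and ij: "i \<in> {1..m}" "j \<in> {1..m}" "i \<noteq> j"
    and r: "r \<in> C" "s \<in> C" "r * x j = x i * s"
  shows "binomial_vector i j r s \<in> carrier (first_syzygy R m x)"
proof -
  have "(\<Sum>k\<in>{1..m}. binomial_vector i j r s k * x k) =
    (\<Sum>k\<in>{1..m}. (if k = j then r * x j else 0) + (if k = i then - s * x i else 0))"
    using ij by (intro sum.cong) (auto simp: binomial_vector_def)
  also have "\<dots> = r * x j - s * x i"
    using ij by (simp add: sum.distrib sum.delta)
  also have "\<dots> = 0"
    using r(3) by (simp add: mult.commute)
  finally show ?thesis
    unfolding syzygy_iff[OF x] using ij r by (auto simp: binomial_vector_def zero_mem uminus_mem)
qed

lemma syzygy_diff: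
  assumes x: "x ` {1..m} \<subseteq> C"
    and "u \<in> carrier (first_syzygy R m x)" "v \<in> carrier (first_syzygy R m x)"
  shows "(\<lambda>k. u k - v k) \<in> carrier (first_syzygy R m x)"
  using assms(2,3) unfolding syzygy_iff[OF x]
  by (auto simp: diff_mem left_diff_distrib sum_subtractf)

lemma entry_ideal_mem:
  assumes A: "\<forall>i\<in>{1..m}. \<forall>l\<in>{1..q}. A i l \<in> C"
  shows "ideal (entry_ideal R m q A) R"
    and "i \<in> {1..m} \<Longrightarrow> l \<in> {1..q} \<Longrightarrow> A i l \<in> entry_ideal R m q A"
proof -
  show "ideal (entry_ideal R m q A) R"
    unfolding entry_ideal_def by (rule genideal_ideal) (use A in auto)
  show "A i l \<in> entry_ideal R m q A" if "i \<in> {1..m}" "l \<in> {1..q}"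
    unfolding entry_ideal_def by (rule subsetD[OF genideal_upper]) (use that in blast)
qed

lemma ideal_sum_closed:
  assumes "ideal J R" "\<And>i. i \<in> K \<Longrightarrow> f i \<in> J"
  shows "sum f K \<in> J"
  using assms(2) by (induction K rule: infinite_finite_induct) (use assms(1) in \<open>auto simp: ideal_iff\<close>)

lemma mat_map_eq:
  assumes A: "\<forall>i\<in>{1..m}. \<forall>l\<in>{1..q}. A i l \<in> C"
    and w: "w \<in> carrier (free_module R q)" and i: "i \<in> {1..m}"
  shows "mat_map R m q A w i = (\<Sum>l\<in>{1..q}. A i l * w l)"
  using finsum_eq_sum[of "{1..q}" "\<lambda>l. A i l * w l"] A w i
  by (auto simp: mat_map_def free_module_def mult_mem)

text \<open>
  The columns of \<open>A\<close> are the images of the unit vectors, hence syzygies.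
\<close>

lemma entry_ideal_least:
  assumes A: "\<forall>i\<in>{1..m}. \<forall>l\<in>{1..q}. A i l \<in> C"
    and im: "mat_map R m q A ` carrier (free_module R q) = carrier (first_syzygy R m x)"
    and J: "ideal J R" "\<And>v i. v \<in> carrier (first_syzygy R m x) \<Longrightarrow> i \<in> {1..m} \<Longrightarrow> v i \<in> J"
  shows "entry_ideal R m q A \<subseteq> J"
  unfolding entry_ideal_def
proof (rule genideal_minimal[OF J(1)], clarify)
  fix i l
  assume il: "i \<in> {1..m}" "l \<in> {1..q}"
  let ?e = "\<lambda>k. if k = l then 1 else 0"
  have e: "?e \<in> carrier (free_module R q)"
    using il one_mem zero_mem by (auto simp: free_module_def)
  then have "mat_map R m q A ?e i \<in> J"
    using im by (intro J(2) il) blast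
  moreover have "mat_map R m q A ?e i = A i l"
    using il by (simp add: mat_map_eq[OF A e] if_distrib[of "\<lambda>t. A i _ * t"] cong: if_cong)
  ultimately show "A i l \<in> J"
    by simp
qed

lemma syzygy_coordinate_in_entry_ideal:
  assumes A: "\<forall>i\<in>{1..m}. \<forall>l\<in>{1..q}. A i l \<in> C"
    and im: "mat_map R m q A ` carrier (free_module R q) = carrier (first_syzygy R m x)"
    and v: "v \<in> carrier (first_syzygy R m x)" and i: "i \<in> {1..m}"
  shows "v i \<in> entry_ideal R m q A"
proof -
  obtain w where w: "w \<in> carrier (free_module R q)" "v = mat_map R m q A w"
    using v unfolding im[symmetric] by blast
  then have "v i = (\<Sum>l\<in>{1..q}. w l * A i l)"
    using mat_map_eq[OF A w(1) i] by (simp add: mult.commute)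
  also have "\<dots> \<in> entry_ideal R m q A"
  proof (rule ideal_sum_closed[OF entry_ideal_mem(1)[OF A]])
    fix l
    assume l: "l \<in> {1..q}"
    then have "w l \<in> C"
      using w by (simp add: free_module_def)
    with l i show "w l * A i l \<in> entry_ideal R m q A"
      using entry_ideal_mem(1)[OF A] entry_ideal_mem(2)[OF A] by (simp add: ideal_iff)
  qed
  finally show ?thesis .
qed

end

locale monomial_sequence = numerical_semigroup_ring S K
  for S and K :: "'k::field itself" +
  fixes m :: nat and x :: "nat \<Rightarrow> 'k poly" and \<beta> :: "nat \<Rightarrow> 'k" and b :: "nat \<Rightarrow> nat"
  assumes x_monom: "i \<in> {1..m} \<Longrightarrow> x i = Polynomial.monom (\<beta> i) (b i)"
    and \<beta>_nz: "i \<in> {1..m} \<Longrightarrow> \<beta> i \<noteq> 0"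
    and b_S: "i \<in> {1..m} \<Longrightarrow> b i \<in> S"
begin

lemma x_C: "x ` {1..m} \<subseteq> C"
  using x_monom b_S by auto

lemma x_nz: "i \<in> {1..m} \<Longrightarrow> x i \<noteq> 0"
  using x_monom \<beta>_nz by simp

abbreviation Syz :: "(nat \<Rightarrow> 'k poly) set"
  where "Syz \<equiv> carrier (first_syzygy R.R m x)"

text \<open>
  The binomial syzygies of pairs \<open>i < j\<close> generate all syzygies. If the coordinate \<open>v j\<close> of a syzygy has a
  term of exponent \<open>e\<close>, then \<open>v j * x j\<close> has a term of exponent \<open>e + b j\<close>, which must be cancelled by a
  term of some \<open>v i * x i\<close> with \<open>i \<noteq> j\<close>. The binomial syzygy of this pair of terms can be subtracted so
  that the term of \<open>v j\<close> disappears and no term with a new exponent is created; the number of terms of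
  \<open>v\<close> drops.
\<close>

lemma syzygy_induct [consumes 1, case_names zero add]:
  assumes v: "v \<in> Syz"
    and zero: "P (\<lambda>_. 0)"
    and add: "\<And>i j r s u. 1 \<le> i \<Longrightarrow> i < j \<Longrightarrow> j \<le> m \<Longrightarrow> r \<in> C \<Longrightarrow> s \<in> C \<Longrightarrow> r * x j = x i * s \<Longrightarrow>
      u \<in> Syz \<Longrightarrow> P u \<Longrightarrow> P (\<lambda>k. u k + binomial_vector i j r s k)"
  shows "P v"
  using v
proof (induction "card {(k, e). Polynomial.coeff (v k) e \<noteq> 0}" arbitrary: v rule: less_induct)
  case less
  note v = less.prems[unfolded R.syzygy_iff[OF x_C]]
  let ?supp = "\<lambda>v. {(k, e). Polynomial.coeff (v k) e \<noteq> (0 :: 'k)}"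
  show ?case
  proof (cases "\<forall>k. v k = 0")
    case True
    then have "v = (\<lambda>_. 0)"
      by auto
    with zero show ?thesis
      by simp
  next
    case False
    then obtain j where "v j \<noteq> 0"
      by blast
    then obtain e where e: "Polynomial.coeff (v j) e \<noteq> 0"
      by (metis leading_coeff_0_iff)
    have j: "j \<in> {1..m}"
      using v \<open>v j \<noteq> 0\<close> by blast
    let ?t = "\<lambda>i. Polynomial.coeff (v i * x i) (e + b j)"
    have t: "?t i = (if b i \<le> e + b j then \<beta> i * Polynomial.coeff (v i) (e + b j - b i) else 0)"
      if "i \<in> {1..m}" for i
      using x_monom[OF that] by (simp add: mult.commute[of "v i"] coeff_monom_mult)
    have "(\<Sum>i\<in>{1..m}. ?t i) = 0"
      using v by (simp flip: coeff_sum)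
    then have "?t j + (\<Sum>i\<in>{1..m} - {j}. ?t i) = 0"
      using j by (simp add: sum.remove)
    moreover have "?t j \<noteq> 0"
      using t[OF j] e \<beta>_nz[OF j] by simp
    ultimately have "(\<Sum>i\<in>{1..m} - {j}. ?t i) \<noteq> 0"
      by auto
    then obtain i where i: "i \<in> {1..m}" "i \<noteq> j" "?t i \<noteq> 0"
      by (metis (no_types, lifting) DiffE insertCI sum.neutral)
    define e' where "e' = e + b j - b i"
    have e': "Polynomial.coeff (v i) e' \<noteq> 0" "e' + b i = e + b j"
      using i t[OF i(1)] by (auto simp: e'_def split: if_splits)
    have eS: "e \<in> S" "e' \<in> S"
      using v i(1) j e e'(1) by (auto simp: supported_def)
    define r where "r = Polynomial.monom (Polynomial.coeff (v j) e) e"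
    define s where "s = Polynomial.monom (Polynomial.coeff (v j) e * \<beta> j / \<beta> i) e'"
    have rs: "r \<in> C" "s \<in> C"
      using eS by (simp_all add: r_def s_def)
    have eq: "r * x j = x i * s"
      using e'(2) \<beta>_nz[OF i(1)] x_monom[OF i(1)] x_monom[OF j]
      by (simp add: r_def s_def mult_monom add.commute)
    let ?B = "binomial_vector i j r s"
    define u where "u = (\<lambda>k. v k - ?B k)"
    have u: "u \<in> Syz"
      unfolding u_def
      by (intro R.syzygy_diff R.binomial_syzygy x_C less.prems i(1,2) j rs eq)
    have "?supp u \<subseteq> ?supp v - {(j, e)}"
      using e e' i by (auto simp: u_def binomial_vector_def r_def s_def split: if_splits)
    moreover have "finite (?supp v)"
    proof (rule finite_subset)
      show "?supp v \<subseteq> (SIGMA k:{1..m}. {..degree (v k)})"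
        using v by (auto intro: le_degree)
    qed auto
    moreover have "(j, e) \<in> ?supp v"
      using e by simp
    ultimately have "finite (?supp v)" "?supp u \<subset> ?supp v"
      by blast+
    then have "card (?supp u) < card (?supp v)"
      by (rule psubset_card_mono)
    then have "P u"
      using u by (rule less.hyps)
    show ?thesis
    proof (cases "i < j")
      case True
      with add[OF _ True _ rs eq u \<open>P u\<close>] i j show ?thesis
        by (simp add: u_def)
    next
      case False
      \<comment> \<open>The same vector read with the two indices exchanged.\<close>
      have "binomial_vector j i (- s) (- r) = ?B"
        using i(2) by (auto simp: binomial_vector_def fun_eq_iff)
      moreover have "- s * x i = x j * - r"
        using eq by (simp add: mult.commute)
      ultimately show ?thesis
        using add[of j i "- s" "- r" u] False i j rs u \<open>P u\<close> R.uminus_mem by (simp add: u_def)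
    qed
  qed
qed

definition colon_sum :: "'k poly set"
  where "colon_sum = ideal_sum R.R {1..m} (\<lambda>j. ideal_sum R.R ({1..m} - {j}) (\<lambda>i. colon R.R (x i) (x j)))"

definition colon_trace_sum :: "'k poly set"
  where "colon_trace_sum = ideal_sum R.R {2..m} (\<lambda>j. ideal_sum R.R {1..<j}
    (\<lambda>i. trace_ideal R.R (ideal_module R.R (colon R.R (x i) (x j)))))"

lemma colon_C: "colon R.R u v \<subseteq> C"
  by (auto simp: R.colon_iff)

lemma ideal_subset_C: "ideal J R.R \<Longrightarrow> J \<subseteq> C"
  by (simp add: R.ideal_iff)

lemma ideal_colon_sum: "ideal colon_sum R.R"
  unfolding colon_sum_def
  by (rule R.ideal_ideal_sum, rule ideal_subset_C, rule R.ideal_ideal_sum, rule colon_C)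

lemma ideal_colon_trace_sum: "ideal colon_trace_sum R.R"
  unfolding colon_trace_sum_def
  by (rule R.ideal_ideal_sum, rule ideal_subset_C, rule R.ideal_ideal_sum, rule R.trace_ideal_subset)

lemma colon_sum_upper:
  assumes "i \<in> {1..m}" "j \<in> {1..m}" "i \<noteq> j"
  shows "colon R.R (x i) (x j) \<subseteq> colon_sum"
proof -
  have "colon R.R (x i) (x j) \<subseteq> ideal_sum R.R ({1..m} - {j}) (\<lambda>i. colon R.R (x i) (x j))"
    by (rule R.ideal_sum_upper) (use assms in simp)
  also have "\<dots> \<subseteq> colon_sum"
    unfolding colon_sum_def by (rule R.ideal_sum_upper) (use assms in simp)
  finally show ?thesis .
qed

lemma colon_sum_least:
  assumes "ideal J R.R"
    and "\<And>i j. i \<in> {1..m} \<Longrightarrow> j \<in> {1..m} \<Longrightarrow> i \<noteq> j \<Longrightarrow> colon R.R (x i) (x j) \<subseteq> J"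
  shows "colon_sum \<subseteq> J"
  unfolding colon_sum_def by (intro R.ideal_sum_least assms) auto

lemma colon_trace_sum_upper:
  assumes "1 \<le> i" "i < j" "j \<le> m"
  shows "trace_ideal R.R (ideal_module R.R (colon R.R (x i) (x j))) \<subseteq> colon_trace_sum"
proof -
  have "trace_ideal R.R (ideal_module R.R (colon R.R (x i) (x j))) \<subseteq>
      ideal_sum R.R {1..<j} (\<lambda>i. trace_ideal R.R (ideal_module R.R (colon R.R (x i) (x j))))"
    by (rule R.ideal_sum_upper) (use assms in simp)
  also have "\<dots> \<subseteq> colon_trace_sum"
    unfolding colon_trace_sum_def by (rule R.ideal_sum_upper) (use assms in simp)
  finally show ?thesis .
qed

lemma syzygy_coordinate_in_colon_sum:
  assumes "v \<in> Syz"
  shows "v k \<in> colon_sum"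
  using assms
proof (induction v rule: syzygy_induct)
  case zero
  then show ?case
    using ideal_colon_sum by (simp add: R.ideal_iff)
next
  case (add i j r s u)
  have "- s * x i = x j * - r"
    using add(6) by (simp add: mult.commute)
  then have "r \<in> colon R.R (x i) (x j)" "- s \<in> colon R.R (x j) (x i)"
    unfolding R.colon_iff using add(4-6) R.uminus_mem by blast+
  then have "r \<in> colon_sum" "- s \<in> colon_sum"
    using colon_sum_upper[of i j] colon_sum_upper[of j i] add(1-3) by auto
  with add.IH ideal_colon_sum show ?case
    by (auto simp: binomial_vector_def R.ideal_iff)
qed

lemma colon_obtain_syzygy:
  assumes "i \<in> {1..m}" "j \<in> {1..m}" "i \<noteq> j" "r \<in> colon R.R (x i) (x j)"
  obtains v where "v \<in> Syz" "v j = r"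
proof -
  obtain s where "r \<in> C" "s \<in> C" "r * x j = x i * s"
    using assms(4) by (auto simp: R.colon_iff)
  then have "binomial_vector i j r s \<in> Syz"
    using assms by (intro R.binomial_syzygy x_C)
  then show thesis
    by (rule that) (simp add: binomial_vector_def)
qed

lemma entry_ideal_eq_colon_sum:
  assumes A: "\<forall>i\<in>{1..m}. \<forall>l\<in>{1..q}. A i l \<in> C"
    and im: "mat_map R.R m q A ` carrier (free_module R.R q) = Syz"
  shows "entry_ideal R.R m q A = colon_sum"
proof
  show "entry_ideal R.R m q A \<subseteq> colon_sum"
    using A im ideal_colon_sum
    by (rule R.entry_ideal_least) (rule syzygy_coordinate_in_colon_sum)
  show "colon_sum \<subseteq> entry_ideal R.R m q A"
  proof (rule colon_sum_least[OF R.entry_ideal_mem(1)[OF A]])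
    fix i j
    assume ij: "i \<in> {1..m}" "j \<in> {1..m}" "i \<noteq> j"
    show "colon R.R (x i) (x j) \<subseteq> entry_ideal R.R m q A"
    proof
      fix r
      assume "r \<in> colon R.R (x i) (x j)"
      with ij obtain v where "v \<in> Syz" "v j = r"
        by (rule colon_obtain_syzygy)
      with R.syzygy_coordinate_in_entry_ideal[OF A im _ ij(2), of v] show "r \<in> entry_ideal R.R m q A"
        by simp
    qed
  qed
qed

text \<open>
  Each element of \<open>(x i : x j)\<close> is the \<open>j\<close>-th coordinate of a syzygy, and taking a coordinate is a linear
  form.
\<close>

lemma colon_sum_subset_trace: "colon_sum \<subseteq> trace_ideal R.R (first_syzygy R.R m x)"
proof (rule colon_sum_least[OF R.ideal_trace_ideal], rule subsetI)
  fix i j r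
  assume ij: "i \<in> {1..m}" "j \<in> {1..m}" "i \<noteq> j" and "r \<in> colon R.R (x i) (x j)"
  then obtain v where v: "v \<in> Syz" "v j = r"
    by (rule colon_obtain_syzygy)
  have "(\<lambda>v. v j) \<in> module_hom R.R (first_syzygy R.R m x) (ring_module R.R)"
    unfolding R.syzygy_hom_iff using ij by (auto simp: R.syzygy_iff[OF x_C])
  from R.trace_ideal_upper[OF this v(1)] v(2)
  show "r \<in> trace_ideal R.R (first_syzygy R.R m x)"
    by simp
qed

text \<open>
  For fixed \<open>i < j\<close> the binomial syzygy \<open>r e j - s e i\<close> with \<open>r x j = s x i\<close> depends linearly on
  \<open>r \<in> (x i : x j)\<close>, since \<open>s = r x j / x i\<close>. A linear form on the syzygies therefore restricts to a
  linear form on \<open>(x i : x j)\<close>.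
\<close>

lemma trace_subset_colon_trace_sum: "trace_ideal R.R (first_syzygy R.R m x) \<subseteq> colon_trace_sum"
proof (rule R.trace_ideal_least[OF ideal_colon_trace_sum])
  note D = ideal_colon_trace_sum[unfolded R.ideal_iff]
  fix f v
  assume "f \<in> module_hom R.R (first_syzygy R.R m x) (ring_module R.R)"
  note f = this[unfolded R.syzygy_hom_iff]
  assume "v \<in> Syz"
  then show "f v \<in> colon_trace_sum"
  proof (induction v rule: syzygy_induct)
    case zero
    have "(\<lambda>_. 0) \<in> Syz"
      by (simp add: R.syzygy_iff[OF x_C])
    moreover have "\<forall>v\<in>Syz. f (\<lambda>i. 0 * v i) = 0 * f v"
      using f R.zero_mem by blast
    ultimately have "f (\<lambda>i. 0) = 0"
      by force
    then show ?case
      using D by simp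
  next
    case (add i j r s u)
    have ij: "i \<in> {1..m}" "j \<in> {1..m}" "i \<noteq> j"
      using add by auto
    let ?B = "\<lambda>r. binomial_vector i j r (r * x j div x i)"
    have s_eq: "r * x j div x i = s" if "r * x j = x i * s" for r s
      using that x_nz[OF ij(1)] by simp
    have B: "?B r \<in> Syz" if r: "r \<in> colon R.R (x i) (x j)" for r
    proof -
      obtain s where "r \<in> C" "s \<in> C" "r * x j = x i * s"
        using r by (auto simp: R.colon_iff)
      then show ?thesis
        using s_eq ij by (auto intro!: R.binomial_syzygy x_C)
    qed
    have B_add: "?B (r + r') = (\<lambda>k. ?B r k + ?B r' k)"
      if r: "r \<in> colon R.R (x i) (x j)" "r' \<in> colon R.R (x i) (x j)" for r r'
    proof -
      obtain s s' where "r * x j = x i * s" "r' * x j = x i * s'"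
        using r by (auto simp: R.colon_iff)
      then have "r * x j div x i = s" "r' * x j div x i = s'" "(r + r') * x j div x i = s + s'"
        by (intro s_eq; simp add: algebra_simps)+
      then show ?thesis
        by (auto simp: binomial_vector_def fun_eq_iff)
    qed
    have B_mult: "?B (c * r) = (\<lambda>k. c * ?B r k)"
      if r: "r \<in> colon R.R (x i) (x j)" for c r
    proof -
      obtain s where "r * x j = x i * s"
        using r by (auto simp: R.colon_iff)
      then have "r * x j div x i = s" "(c * r) * x j div x i = c * s"
        by (intro s_eq; simp add: algebra_simps)+
      then show ?thesis
        by (auto simp: binomial_vector_def fun_eq_iff)
    qed
    have "(\<lambda>r. f (?B r)) \<in> module_hom R.R (ideal_module R.R (colon R.R (x i) (x j))) (ring_module R.R)"
      unfolding R.module_hom_ideal_iff using f B by (simp add: B_add B_mult)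
    moreover have r: "r \<in> colon R.R (x i) (x j)"
      using add by (auto simp: R.colon_iff)
    ultimately have "f (?B r) \<in> trace_ideal R.R (ideal_module R.R (colon R.R (x i) (x j)))"
      by (intro R.trace_ideal_upper[where f = "\<lambda>r. f (?B r)"]) (simp_all add: ideal_module_def)
    then have "f (?B r) \<in> colon_trace_sum"
      using colon_trace_sum_upper[of i j] add by blast
    moreover have "?B r = binomial_vector i j r s"
      by (simp only: s_eq[OF add(6)])
    moreover have "f (\<lambda>k. u k + ?B r k) = f u + f (?B r)"
      using f add(7) B[OF r] by blast
    ultimately show ?case
      using add.IH D by simp
  qed
qed

lemma colon_trace_sum_subset:
  assumes refl: "\<And>i j. i \<in> {1..m} \<Longrightarrow> j \<in> {1..m} \<Longrightarrow> i \<noteq> j \<Longrightarrow>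
    reflexive_module R.R (ideal_module R.R (genideal R.R {x i, x j}))"
  shows "colon_trace_sum \<subseteq> colon_sum"
  unfolding colon_trace_sum_def
proof (intro R.ideal_sum_least ideal_colon_sum)
  fix j i
  assume "j \<in> {2..m}" "i \<in> {1..<j}"
  then have "i \<in> {1..m}" "j \<in> {1..m}" "i \<noteq> j"
    by auto
  then show "trace_ideal R.R (ideal_module R.R (colon R.R (x i) (x j))) \<subseteq> colon_sum"
    using x_C by (intro R.trace_colon_subset x_nz refl ideal_colon_sum colon_sum_upper) auto
qed

end


section \<open>Finitely generated numerical semigroups\<close>

lemma generated_semigroup_zero: "0 \<in> generated_semigroup G"
  unfolding generated_semigroup_def by (intro CollectI exI[of _ "\<lambda>_. 0"]) simp

lemma generated_semigroup_add:
  "s \<in> generated_semigroup G \<Longrightarrow> s' \<in> generated_semigroup G \<Longrightarrow> s + s' \<in> generated_semigroup G"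
  unfolding generated_semigroup_def
proof clarify
  fix c c'
  show "\<exists>d. (\<Sum>g\<in>G. c g * g) + (\<Sum>g\<in>G. c' g * g) = (\<Sum>g\<in>G. d g * g) \<and> True"
    by (intro exI[of _ "\<lambda>g. c g + c' g"]) (simp add: sum.distrib distrib_right)
qed

lemma generated_semigroup_generator:
  assumes "finite G" "g \<in> G"
  shows "g \<in> generated_semigroup G"
proof -
  have "g = (\<Sum>h\<in>G. (if h = g then 1 else 0) * h)"
    using assms by (simp add: if_distrib[of "\<lambda>t. t * _"] cong: if_cong)
  then show ?thesis
    unfolding generated_semigroup_def by (intro CollectI exI[of _ "\<lambda>h. if h = g then 1 else 0"]) simp
qed

lemma generated_semigroup_mult:
  "s \<in> generated_semigroup G \<Longrightarrow> k * s \<in> generated_semigroup G"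
  by (induction k) (auto simp: generated_semigroup_zero generated_semigroup_add)

lemma generated_semigroup_induct [consumes 2, case_names zero add]:
  assumes "s \<in> generated_semigroup G" "finite G"
    and zero: "P 0" and add: "\<And>g s. g \<in> G \<Longrightarrow> P s \<Longrightarrow> P (g + s)"
  shows "P s"
proof -
  obtain c where c: "s = (\<Sum>g\<in>G. c g * g)"
    using assms(1) by (auto simp: generated_semigroup_def)
  have "P (\<Sum>g\<in>H. c g * g)" if "finite H" "H \<subseteq> G" for H
    using that
  proof (induction H rule: finite_induct)
    case (insert h H)
    have "P (k * h + (\<Sum>g\<in>H. c g * g))" for k
      using insert add by (induction k) (auto simp: add.assoc)
    with insert show ?case
      by simp
  qed (simp add: zero)
  with assms(2) show ?thesis
    unfolding c by blast
qed

text \<open>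
  The least positive difference \<open>d\<close> of two elements of the semigroup divides every generator, because
  the remainder of a generator modulo \<open>d\<close> is again such a difference. So \<open>d = 1\<close>, and the semigroup
  contains consecutive numbers \<open>q\<close> and \<open>q + 1\<close>. Every \<open>n \<ge> q\<^sup>2\<close> is a combination of these: if \<open>n\<close> has
  quotient \<open>k \<ge> q\<close> and remainder \<open>r < q\<close> modulo \<open>q\<close>, then \<open>n = (k - r) q + r (q + 1)\<close>.
\<close>

lemma finite_complement_generated_semigroup:
  assumes G: "finite G" and gcd: "Gcd G = 1"
  shows "finite (- generated_semigroup G)"
proof -
  let ?S = "generated_semigroup G"
  define D where "D = {d. 0 < d \<and> (\<exists>q\<in>?S. q + d \<in> ?S)}"
  obtain g0 where "g0 \<in> G" "g0 \<noteq> 0"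
    using gcd by (metis Gcd_0_iff insertI1 subsetI zero_neq_one)
  then have "g0 \<in> D"
    using generated_semigroup_zero generated_semigroup_generator[OF G]
    by (auto simp: D_def intro!: bexI[of _ 0])
  define d where "d = (LEAST d. d \<in> D)"
  have d: "d \<in> D" and least: "\<And>d'. d' \<in> D \<Longrightarrow> d \<le> d'"
    using \<open>g0 \<in> D\<close> by (auto simp: d_def intro: LeastI Least_le)
  then obtain q where q: "q \<in> ?S" "q + d \<in> ?S"
    by (auto simp: D_def)
  have "d dvd g" if "g \<in> G" for g
  proof (rule ccontr)
    assume "\<not> d dvd g"
    then have pos: "0 < g mod d"
      by (simp add: mod_greater_zero_iff_not_dvd)
    have "(g div d) * (q + d) + g mod d = g + (g div d) * q"
      by (simp add: algebra_simps)
    then have "g mod d \<in> D"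
      using pos generated_semigroup_mult[OF q(2)] generated_semigroup_mult[OF q(1)]
        generated_semigroup_add generated_semigroup_generator[OF G that]
      unfolding D_def by (metis (mono_tags, lifting) mem_Collect_eq)
    with least have "d \<le> g mod d"
      by blast
    moreover have "g mod d < d"
      using d by (simp add: D_def)
    ultimately show False
      by simp
  qed
  then have "d dvd 1"
    unfolding gcd[symmetric] by (rule Gcd_greatest)
  with q have q1: "q + 1 \<in> ?S"
    by simp
  have "n \<in> ?S" if n: "q * q \<le> n" for n
  proof (cases "q = 0")
    case True
    with generated_semigroup_mult[OF q1, of n] show ?thesis
      by simp
  next
    case False
    have "q \<le> n div q"
      using n False by (simp add: less_eq_div_iff_mult_less_eq)
    with False have "n mod q \<le> n div q"
      by (meson le_trans less_imp_le mod_less_divisor neq0_conv)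
    then have "(n div q - n mod q) * q + (n mod q) * (q + 1) = (n div q) * q + n mod q"
      by (simp add: diff_mult_distrib algebra_simps)
    then have "n = (n div q - n mod q) * q + (n mod q) * (q + 1)"
      by simp
    with generated_semigroup_add[OF generated_semigroup_mult[OF q(1)] generated_semigroup_mult[OF q1]]
    show ?thesis
      by metis
  qed
  then have "- ?S \<subseteq> {..<q * q}"
    by (auto simp: not_le[symmetric])
  then show ?thesis
    by (rule finite_subset) simp
qed

lemma class_ring_a_inv: "\<ominus>\<^bsub>class_ring\<^esub> u = - (u :: 'a::idom)"
proof -
  interpret whole: domain_subring "UNIV :: 'a set"
    by unfold_locales auto
  have "class_ring\<lparr>carrier := UNIV\<rparr> = (class_ring :: 'a ring)" "carrier (class_ring :: 'a ring) = UNIV"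
    by (simp_all add: class_ring_def)
  with whole.minus_equality[of "- u" u, unfolded this(1)] show ?thesis
    by simp
qed

lemma generate_ring_eq_supported:
  fixes G :: "nat set"
  assumes G: "finite G"
  shows "generate_ring class_ring (range (\<lambda>c. [:c:]) \<union> Polynomial.monom 1 ` G) =
    (supported (generated_semigroup G) :: 'k::field poly set)" (is "?L = supported ?S")
proof
  show "?L \<subseteq> supported ?S"
  proof
    fix p
    assume "p \<in> ?L"
    then show "p \<in> supported ?S"
    proof (induction p rule: generate_ring.induct)
      case one
      show ?case
        using supported_monom[of 1 0 ?S] generated_semigroup_zero by simp
    next
      case (incl p)
      moreover have "[:c:] \<in> supported ?S" for c :: 'k
        using supported_monom[of c 0 ?S] generated_semigroup_zero by (simp add: monom_0)
      ultimately show ?case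
        using generated_semigroup_generator[OF G] by auto
    next
      case (a_inv p)
      then show ?case
        by (simp add: class_ring_a_inv supported_def)
    next
      case (eng_add p q)
      then show ?case
        by (simp add: supported_add)
    next
      case (eng_mult p q)
      then show ?case
        using supported_mult generated_semigroup_add by (metis class_ring_simps(1))
    qed
  qed
  have const: "[:c:] \<in> ?L" for c :: 'k
    by (rule generate_ring.incl) simp
  have mult: "p * q \<in> ?L" if "p \<in> ?L" "q \<in> ?L" for p q :: "'k poly"
    using generate_ring.eng_mult[OF that] by simp
  have monom: "Polynomial.monom (1 :: 'k) s \<in> ?L" if "s \<in> ?S" for s
    using that G
  proof (induction s rule: generated_semigroup_induct)
    case zero
    then show ?case
      using const[of 1] by (simp add: monom_0)
  next
    case (add g s)
    have "Polynomial.monom 1 g \<in> ?L"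
      by (rule generate_ring.incl) (use add in simp)
    from mult[OF this add(2)] show ?case
      by (simp add: mult_monom)
  qed
  show "supported ?S \<subseteq> ?L"
  proof
    fix p :: "'k poly"
    assume "p \<in> supported ?S"
    then show "p \<in> ?L"
    proof (induction p rule: supported_induct)
      case zero
      then show ?case
        using const[of 0] by simp
    next
      case (monom c \<tau>)
      from mult[OF const[of c] this[THEN \<open>\<And>s. s \<in> ?S \<Longrightarrow> Polynomial.monom 1 s \<in> ?L\<close>]] show ?case
        by (simp add: smult_monom)
    next
      case (add p q)
      from generate_ring.eng_add[OF add(3,4)] show ?case
        by simp
    qed
  qed
qed

section \<open>Trace ideals of syzygies over semigroup rings\<close>

text \<open>
  A zero generator could be omitted.
\<close>

lemma minimal_generators_nonzero:
  assumes R: "domain_subring C"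
    and min: "minimal_homogeneous_generators (class_ring\<lparr>carrier := C\<rparr>) I m x" and i: "i \<in> {1..m}"
  shows "x i \<noteq> 0"
proof
  interpret R: domain_subring C by (rule R)
  assume "x i = 0"
  note min = min[unfolded minimal_homogeneous_generators_def]
  have x: "x ` {1..m} \<subseteq> carrier R.R"
    using min by auto
  let ?J = "genideal R.R (x ` ({1..m} - {i}))"
  have J: "ideal ?J R.R"
    by (rule R.genideal_ideal) (use x in blast)
  have "?J \<subseteq> genideal R.R (x ` {1..m})"
    by (rule R.genideal_minimal[OF R.genideal_ideal[OF x]])
      (rule subset_trans[OF _ R.genideal_upper], blast)
  moreover have "genideal R.R (x ` {1..m}) \<subseteq> ?J"
  proof (rule R.genideal_minimal[OF J], rule subsetI)
    fix y
    assume "y \<in> x ` {1..m}"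
    then consider "y = 0" | "y \<in> x ` ({1..m} - {i})"
      using \<open>x i = 0\<close> by blast
    then show "y \<in> ?J"
    proof cases
      case 1
      with J show ?thesis
        by (simp add: R.ideal_iff)
    next
      case 2
      then show ?thesis
        by (rule subsetD[OF R.genideal_upper])
    qed
  qed
  ultimately show False
    using min i by blast
qed

lemma homogeneous_eq_monom:
  "homogeneous p d \<Longrightarrow> p = Polynomial.monom (Polynomial.coeff p d) d"
  by (rule poly_eqI) (auto simp: homogeneous_def)

theorem proposition3p6:
  fixes n m q :: nat
    and a :: "nat \<Rightarrow> nat"
    and R :: "'k::field poly ring"
    and I :: "'k poly set"
    and x :: "nat \<Rightarrow> 'k poly"
    and A :: "nat \<Rightarrow> nat \<Rightarrow> 'k poly"
  assumes "minimal_semigroup_generators n a"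
    and "R = semigroup_ring n a"
    and "homogeneous_ideal I R"
    and "minimal_homogeneous_generators R I m x"
    and "minimal_homogeneous_presentation R m x q A"
  shows "entry_ideal R m q A =
           ideal_sum R {1..m} (\<lambda>j. ideal_sum R ({1..m} - {j}) (\<lambda>i. colon R (x i) (x j)))
       \<and> ideal_sum R {1..m} (\<lambda>j. ideal_sum R ({1..m} - {j}) (\<lambda>i. colon R (x i) (x j)))
           \<subseteq> trace_ideal R (first_syzygy R m x)
       \<and> trace_ideal R (first_syzygy R m x)
           \<subseteq> ideal_sum R {2..m} (\<lambda>j. ideal_sum R {1..<j}
               (\<lambda>i. trace_ideal R (ideal_module R (colon R (x i) (x j)))))
       \<and> ((\<forall>i\<in>{1..m}. \<forall>j\<in>{1..m}. i \<noteq> j \<longrightarrow>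
              reflexive_module R (ideal_module R (genideal R {x i, x j}))) \<longrightarrow>
            ideal_sum R {1..m} (\<lambda>j. ideal_sum R ({1..m} - {j}) (\<lambda>i. colon R (x i) (x j)))
              = trace_ideal R (first_syzygy R m x)
          \<and> trace_ideal R (first_syzygy R m x)
              = ideal_sum R {2..m} (\<lambda>j. ideal_sum R {1..<j}
                  (\<lambda>i. trace_ideal R (ideal_module R (colon R (x i) (x j))))))
       \<and> (gorenstein_ring TYPE('u) R \<longrightarrow>
            (\<forall>i\<in>{1..m}. \<forall>j\<in>{1..m}. i \<noteq> j \<longrightarrow>
              reflexive_module R (ideal_module R (genideal R {x i, x j}))))"
proof -
  define S where "S = generated_semigroup (a ` {1..n})"
  interpret N: numerical_semigroup_ring S "TYPE('k)"
  proof
    show "0 \<in> S"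
      unfolding S_def by (rule generated_semigroup_zero)
    show "s + s' \<in> S" if "s \<in> S" "s' \<in> S" for s s'
      using that unfolding S_def by (rule generated_semigroup_add)
    show "finite (- S)"
      unfolding S_def using assms(1)
      by (intro finite_complement_generated_semigroup) (simp_all add: minimal_semigroup_generators_def)
  qed
  have "(\<lambda>i. Polynomial.monom (1 :: 'k) (a i)) ` {1..n} = Polynomial.monom 1 ` a ` {1..n}"
    by (simp only: image_image)
  then have R: "R = N.R.R"
    unfolding assms(2) semigroup_ring_def S_def
    by (simp only: generate_ring_eq_supported finite_imageI finite_atLeastAtMost)
  note gens = assms(4)[unfolded R]
  have "\<exists>d. \<forall>i\<in>{1..m}. homogeneous (x i) (d i)"
    using gens unfolding minimal_homogeneous_generators_def by (intro bchoice) blast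
  then obtain b where b: "\<And>i. i \<in> {1..m} \<Longrightarrow> homogeneous (x i) (b i)"
    by blast
  define \<beta> where "\<beta> i = Polynomial.coeff (x i) (b i)" for i
  have x: "x i = Polynomial.monom (\<beta> i) (b i)" if "i \<in> {1..m}" for i
    unfolding \<beta>_def using b[OF that] by (rule homogeneous_eq_monom)
  have nz: "\<beta> i \<noteq> 0" if "i \<in> {1..m}" for i
    using minimal_generators_nonzero[OF N.R.domain_subring_axioms gens that] x[OF that] by auto
  have bS: "b i \<in> S" if "i \<in> {1..m}" for i
  proof -
    have "x i \<in> supported S"
      using gens that by (simp add: minimal_homogeneous_generators_def)
    with nz[OF that] show ?thesis
      unfolding x[OF that] by simp
  qed
  interpret X: monomial_sequence S "TYPE('k)" m x \<beta> b
    by unfold_locales (fact x nz bS)+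
  have A: "\<forall>i\<in>{1..m}. \<forall>l\<in>{1..q}. A i l \<in> supported S"
    and im: "mat_map N.R.R m q A ` carrier (free_module N.R.R q) = X.Syz"
    using assms(5) unfolding R minimal_homogeneous_presentation_def by auto
  \<comment> \<open>The three ideals always form an ascending chain; reflexivity bounds the largest by the smallest.\<close>
  have equalities: "X.colon_sum = trace_ideal N.R.R (first_syzygy N.R.R m x)
      \<and> trace_ideal N.R.R (first_syzygy N.R.R m x) = X.colon_trace_sum"
    if "\<forall>i\<in>{1..m}. \<forall>j\<in>{1..m}. i \<noteq> j \<longrightarrow>
        reflexive_module N.R.R (ideal_module N.R.R (genideal N.R.R {x i, x j}))"
    using X.colon_sum_subset_trace X.trace_subset_colon_trace_sum X.colon_trace_sum_subset that
    by blast
  have "reflexive_module N.R.R (ideal_module N.R.R (genideal N.R.R {x i, x j}))"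
    if "gorenstein_ring TYPE('u) N.R.R" "i \<in> {1..m}" "j \<in> {1..m}" for i j
    unfolding x[OF that(2)] x[OF that(3)] using that nz bS
    by (intro N.gorenstein_reflexive_monomial_pair) auto
  with equalities show ?thesis
    unfolding R X.colon_sum_def[symmetric] X.colon_trace_sum_def[symmetric]
    using X.entry_ideal_eq_colon_sum[OF A im] X.colon_sum_subset_trace X.trace_subset_colon_trace_sum
    by blast
qed

end
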